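(* There is an absolute constant $C>0$ such that the following holds. Let $\mathbf{P}$ be a symmetric GAP of rank $d\ge 0$ in a torsion-free additive group $G$, and let $t\ge 1$ be real. Then there exists a $t$-proper symmetric GAP $\mathbf{Q}$ in $G$ of rank at most $d$ such that $$\operatorname{Image}(\mathbf{P}_{t'})\subseteq \operatorname{Image}\big(\mathbf{Q}_{(Cd)^{3d/2}tt'}\big)\quad\text{for all } t'>0,$$ $$\operatorname{Image}(\mathbf{Q}_{tt'})\subseteq \operatorname{Image}(\mathbf{P}_{t'})\quad\text{for all } t'\ge 1.$$ In particular, $\operatorname{Image}(\mathbf{Q})\subseteq\operatorname{Image}(\mathbf{P})\subseteq\operatorname{Image}\big(\mathbf{Q}_{(Cd)^{3d/2}t}\big)$. Furthermore, $$t^{-d}\,2^{-d^2-Cd\log(d+1)}\operatorname{size}(\mathbf{P})\le\operatorname{size}(\mathbf{Q})\le\operatorname{size}(\mathbf{P}).$$ Finally, if $\mathbf{P}$ is not $1/2$-proper, then $\mathbf{Q}$ can be chosen to have rank at most $d-1$ while still being a $t$-proper symmetric GAP in $G$ satisfying $\operatorname{Image}(\mathbf{P}_{t'})\subseteq \operatorname{Image}\big(\mathbf{Q}_{(Cd)^{3d/2}tt'}\big)$ for all $t'>0$, $\operatorname{Image}(\mathbf{Q}_{tt'})\subseteq \operatorname{Image}(\mathbf{P}_{t'})$ for all $t'\ge 1$, and $t^{-d}\,2^{-d^2-Cd\log(d+1)}\operatorname{size}(\mathbf{P})\le\operatorname{size}(\mathbf{Q})\le\operatorname{size}(\mathbf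{P})$.
   Context: An additive group is an abelian group written additively; it is torsion-free if $nx\ne 0$ for all nonzero $x\in G$ and all nonzero integers $n$. A symmetric generalized arithmetic progression (symmetric GAP) in $G$ is a triple $\mathbf{P}=(N,v,d)$, where $d=\operatorname{rank}(\mathbf{P})\ge 0$ is an integer, $N=(N_1,\dots,N_d)$ is a tuple of positive reals (the dimensions) and $v=(v_1,\dots,v_d)$ is a tuple of elements of $G$ (the steps). Its image is $\operatorname{Image}(\mathbf{P}):=\{\sum_{i=1}^d n_iv_i: n_i\in\mathbb{Z},\ |n_i|\le N_i\}\subseteq G$, and its size is $\operatorname{size}(\mathbf{P}):=|\operatorname{Image}(\mathbf{P})|$. For real $t>0$ the dilate is $\mathbf{P}_t:=(tN,v,d)$. $\mathbf{P}$ is proper if the elements $\sum_i n_iv_i$, for integers $n_i$ with $|n_i|\le N_i$, are all distinct; it is $t$-proper if $\mathbf{P}_t$ is proper. Convention: $0^0=1$. *)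

theory Defs
  imports Complex_Main "HOL-Library.FuncSet" "HOL-Library.Poly_Mapping"
begin

definition int_scale :: "int \<Rightarrow> 'a::ab_group_add \<Rightarrow> 'a" where
  "int_scale n x =
     (if 0 \<le> n then (\<Sum>_<nat n. x) else - (\<Sum>_<nat (- n). x))"

text \<open>The ambient group is the whole type \<open>'a\<close>.\<close>

definition torsion_free_group :: "'a::ab_group_add itself \<Rightarrow> bool" where
  "torsion_free_group _ \<longleftrightarrow>
     (\<forall>(n::int) (x::'a). n \<noteq> 0 \<longrightarrow> x \<noteq> 0 \<longrightarrow> int_scale n x \<noteq> 0)"

text \<open>The tuples \<open>(N\<^sub>1, \<dots>, N\<^sub>d)\<close> and \<open>(v\<^sub>1, \<dots>, v\<^sub>d)\<close> are functions read at the
  indices \<open>0, \<dots>, d - 1\<close> only.\<close>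

datatype 'a gap =
  GAP (gap_dims: "nat \<Rightarrow> real") (gap_steps: "nat \<Rightarrow> 'a") (gap_rank: nat)

definition symmetric_gap :: "'a gap \<Rightarrow> bool" where
  "symmetric_gap P \<longleftrightarrow> (\<forall>i<gap_rank P. 0 < gap_dims P i)"

definition gap_box :: "'a gap \<Rightarrow> (nat \<Rightarrow> int) set" where
  "gap_box P =
     (\<Pi>\<^sub>E i\<in>{..<gap_rank P}. {k. \<bar>real_of_int k\<bar> \<le> gap_dims P i})"

definition gap_sum :: "'a::ab_group_add gap \<Rightarrow> (nat \<Rightarrow> int) \<Rightarrow> 'a" where
  "gap_sum P n = (\<Sum>i<gap_rank P. int_scale (n i) (gap_steps P i))"

definition gap_image :: "'a::ab_group_add gap \<Rightarrow> 'a set" where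
  "gap_image P = gap_sum P ` gap_box P"

definition gap_size :: "'a::ab_group_add gap \<Rightarrow> nat" where
  "gap_size P = card (gap_image P)"

definition gap_dilate :: "real \<Rightarrow> 'a gap \<Rightarrow> 'a gap" where
  "gap_dilate t P = GAP (\<lambda>i. t * gap_dims P i) (gap_steps P) (gap_rank P)"

definition gap_proper :: "'a::ab_group_add gap \<Rightarrow> bool" where
  "gap_proper P \<longleftrightarrow> inj_on (gap_sum P) (gap_box P)"

definition gap_t_proper :: "real \<Rightarrow> 'a::ab_group_add gap \<Rightarrow> bool" where
  "gap_t_proper t P \<longleftrightarrow> gap_proper (gap_dilate t P)"

text \<open>This is \<open>(C d)\<^bsup>3d/2\<^esup>\<close> with \<open>0\<^bsup>0\<^esup> = 1\<close>; the case distinction is needed because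
  \<open>0 powr 0 = 0\<close>.\<close>

definition dilation_factor :: "real \<Rightarrow> nat \<Rightarrow> real" where
  "dilation_factor C d =
     (if d = 0 then 1 else (C * real d) powr (3 * real d / 2))"

text \<open>The requirements on \<open>Q\<close>, apart from the bound on its rank.\<close>

definition proper_approximation ::
    "real \<Rightarrow> real \<Rightarrow> 'a::ab_group_add gap \<Rightarrow> 'a gap \<Rightarrow> bool" where
  "proper_approximation C t P Q \<longleftrightarrow>
     symmetric_gap Q \<and> gap_t_proper t Q \<and>
     (\<forall>t'>0. gap_image (gap_dilate t' P)
        \<subseteq> gap_image (gap_dilate (dilation_factor C (gap_rank P) * t * t') Q)) \<and>
     (\<forall>t'\<ge>1. gap_image (gap_dilate (t * t') Q) \<subseteq> gap_image (gap_dilate t' P)) \<and>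
     t powr (- real (gap_rank P))
       * 2 powr (- (real (gap_rank P))\<^sup>2 - C * real (gap_rank P) * ln (real (gap_rank P) + 1))
       * real (gap_size P) \<le> real (gap_size Q) \<and>
     gap_size Q \<le> gap_size P"

text \<open>In a statement \<open>\<exists>C>0. \<dots>\<close> about a type variable \<open>'a\<close> the number \<open>C\<close> could depend
  on \<open>'a\<close>, that is, on the ambient group, and HOL has no quantifier over types to put
  after \<open>\<exists>C\<close>. An absolute constant is therefore a closed term of type \<^typ>\<open>real\<close>: here, some
  \<open>C\<close> that is valid in the free abelian group on countably many generators. Asserting that
  this very number is valid in every torsion-free group is equivalent to the existence of an
  absolute constant: the steps of a GAP generate a finitely generated torsion-free group,
  hence a free one of finite rank, and the steps of \<open>Q\<close> lie in the group generated by those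
  of \<open>P\<close> (take \<open>t'\<close> large in the second inclusion).\<close>

definition gap_constant :: real where
  "gap_constant = (SOME C. 0 < C \<and>
     (\<forall>(P :: (nat, int) poly_mapping gap) t. symmetric_gap P \<longrightarrow> 1 \<le> t \<longrightarrow>
        (\<exists>Q. gap_rank Q \<le> gap_rank P \<and> proper_approximation C t P Q) \<and>
        (\<not> gap_t_proper (1/2) P \<longrightarrow>
           (\<exists>Q. int (gap_rank Q) \<le> int (gap_rank P) - 1 \<and> proper_approximation C t P Q))))"

end

theory Submission
  imports Defs "HOL-Library.Function_Algebras"
begin

text \<open>Identify \<open>\<int>\<^sup>d\<close> with a lattice under the Euclidean form \<open>\<Sum>\<^sub>i x\<^sub>i\<^sup>2 / N\<^sub>i\<^sup>2\<close>, which is within a factor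
  \<open>\<surd>d\<close> of the box. Quotients are taken by replacing a form by its Schur complement, the form of the
  orthogonal projection, on the same group, so the quotient lattice is the group modulo the null
  vectors. As long as the kernel of \<open>\<int>\<^sup>d \<rightarrow> G\<close> contains a non-null vector of length at most
  \<open>1 / (2 \<surd>d)\<close>, divide it out. Each division costs a quarter of its squared length when an element is
  lifted back, so all lifts together stay small. In the remaining lattice a Korkine--Zolotarev type
  reduced basis \<open>b\<close> satisfies \<open>\<Sum>\<^sub>i \<bar>k\<^sub>i\<bar> \<parallel>b\<^sub>i\<parallel> \<le> 2\<^sup>m \<parallel>\<Sum>\<^sub>i k\<^sub>i b\<^sub>i\<parallel>\<close>; the images of the \<open>b\<^sub>i\<close>, with dimensions
  proportional to \<open>1 / \<parallel>b\<^sub>i\<parallel>\<close>, form \<open>Q\<close>. The constant \<open>64\<close> works for every torsion-free group; since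
  \<open>gap_constant\<close> is only known to work for one free group, its validity is transported along an
  embedding of the group generated by the steps of \<open>P\<close>.\<close>

section \<open>Integer multiples and linear combinations in abelian groups\<close>

lemma int_scale_0 [simp]: "int_scale 0 x = 0"
  by (simp add: int_scale_def)

lemma int_scale_plus_one: "int_scale (n + 1) x = int_scale n x + x"
proof (cases "0 \<le> n")
  case True
  then have "nat (n + 1) = Suc (nat n)" by simp
  with True show ?thesis by (simp add: int_scale_def)
next
  case False
  then have "nat (- n) = Suc (nat (- (n + 1)))" by simp
  then have "(\<Sum>_<nat (- n). x) = (\<Sum>_<nat (- (n + 1)). x) + x"
    by (simp only: sum.lessThan_Suc)
  with False show ?thesis by (cases "n = -1") (simp_all add: int_scale_def)
qed

lemma int_scale_1 [simp]: "int_scale 1 x = x"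
  using int_scale_plus_one[of 0 x] by simp

lemma int_scale_minus_one: "int_scale (n - 1) x = int_scale n x - x"
  using int_scale_plus_one[of "n - 1" x] by simp

lemma additive_int_scale:
  assumes "additive h"
  shows "h (int_scale n x) = int_scale n (h x)"
proof (induction n rule: int_induct[where k = 0])
  case base
  show ?case using additive.zero[OF assms] by simp
next
  case (step1 n)
  then show ?case by (simp add: int_scale_plus_one additive.add[OF assms])
next
  case (step2 n)
  then show ?case by (simp add: int_scale_minus_one additive.diff[OF assms])
qed

lemma int_scale_add_left: "int_scale (m + n) x = int_scale m x + int_scale n x"
proof (induction n rule: int_induct[where k = 0])
  case (step1 n)
  then show ?case using int_scale_plus_one[of "m + n" x] by (simp add: int_scale_plus_one add.assoc)
next
  case (step2 n)
  then show ?case using int_scale_minus_one[of "m + n" x]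
    by (simp add: int_scale_minus_one algebra_simps)
qed simp

lemma additive_int_scale_left: "additive (\<lambda>n. int_scale n x)"
  by (simp add: additive_def int_scale_add_left)

lemma int_scale_of_int: "int_scale n (x::'a::ring_1) = of_int n * x"
  by (induction n rule: int_induct[where k = 0])
    (simp_all add: int_scale_plus_one int_scale_minus_one algebra_simps)

text \<open>Not a simplification rule in general: pointwise multiplication makes functions into a ring.\<close>

lemma int_scale_number [simp]:
  "int_scale n (x::real) = of_int n * x"
  "int_scale n (y::int) = n * y"
  by (simp_all add: int_scale_of_int)

lemma int_scale_mult: "int_scale (m * n) x = int_scale m (int_scale n x)"
  using additive_int_scale[OF additive_int_scale_left, of m n x] by simp

lemma int_scale_add_right: "int_scale n (x + y) = int_scale n x + int_scale n y"
  by (induction n rule: int_induct[where k = 0])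
    (simp_all add: int_scale_plus_one int_scale_minus_one algebra_simps)

lemma additive_int_scale_right: "additive (int_scale n)"
  by (simp add: additive_def int_scale_add_right)

lemmas int_scale_diff_left = additive.diff[OF additive_int_scale_left]
lemmas int_scale_diff_right = additive.diff[OF additive_int_scale_right]
lemmas int_scale_sum_right = additive.sum[OF additive_int_scale_right]
lemmas int_scale_sum_left = additive.sum[OF additive_int_scale_left]
lemmas int_scale_zero_right = additive.zero[OF additive_int_scale_right]

lemma int_scale_fun [simp]: "int_scale n (x :: 'i \<Rightarrow> int) i = n * x i"
  using additive_int_scale[of "\<lambda>x. x i" n x] by (simp add: additive_def)

lemma torsion_free_int_scale:
  assumes "torsion_free_group TYPE('a::ab_group_add)" "n \<noteq> 0" "int_scale n (x::'a) = 0"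
  shows "x = 0"
  using assms unfolding torsion_free_group_def by blast

definition lincomb :: "nat \<Rightarrow> (nat \<Rightarrow> int) \<Rightarrow> (nat \<Rightarrow> 'b::ab_group_add) \<Rightarrow> 'b" where
  "lincomb m k b = (\<Sum>i<m. int_scale (k i) (b i))"

lemma additive_lincomb: "additive h \<Longrightarrow> h (lincomb m k b) = lincomb m k (h \<circ> b)"
  by (simp add: lincomb_def additive.sum additive_int_scale)

lemma lincomb_diff: "lincomb m (\<lambda>i. k i - l i) b = lincomb m k b - lincomb m l b"
  by (simp add: lincomb_def int_scale_diff_left sum_subtractf)

lemma lincomb_cong: "(\<And>i. i < m \<Longrightarrow> k i = l i) \<Longrightarrow> lincomb m k b = lincomb m l b"
  by (simp add: lincomb_def)

section \<open>Lattices as groups with a semidefinite form\<close>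

text \<open>For \<open>f b b > 0\<close> this is the form of the components orthogonal to
  \<open>b\<close>. It lives on the same group, where \<open>b\<close> becomes a null vector, so
  iterated quotients stay within one type.\<close>

definition schur :: "('b \<Rightarrow> 'b \<Rightarrow> real) \<Rightarrow> 'b \<Rightarrow> 'b \<Rightarrow> 'b \<Rightarrow> real" where
  "schur f b x y = f x y - f x b * f y b / f b b"

text \<open>The group modulo the null vectors of \<open>f\<close> has rational rank at most \<open>r\<close>.\<close>

definition rank_le :: "('b::ab_group_add \<Rightarrow> 'b \<Rightarrow> real) \<Rightarrow> nat \<Rightarrow> bool" where
  "rank_le f r \<longleftrightarrow> (\<exists>E. finite E \<and> card E \<le> r \<and>
     (\<forall>x. \<exists>n k. n \<noteq> 0 \<and>
        (let z = int_scale n x - (\<Sum>e\<in>E. int_scale (k e) e) in f z z = 0)))"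

text \<open>The group has no real scalars, so arguments about the form work with integer multiples
  and the Archimedean property.\<close>

locale psd_form =
  fixes f :: "'b::ab_group_add \<Rightarrow> 'b \<Rightarrow> real"
  assumes add_left: "f (x + y) z = f x z + f y z"
    and sym: "f x y = f y x"
    and nonneg: "0 \<le> f x x"
begin

lemma additive_left: "additive (\<lambda>x. f x y)"
  by (simp add: additive_def add_left)

lemma additive_right: "additive (f x)"
  using additive_left[of x] by (simp add: additive_def sym[of x])

lemmas add_right = additive.add[OF additive_right]
lemmas diff_left = additive.diff[OF additive_left]
lemmas diff_right = additive.diff[OF additive_right]
lemmas zero_left = additive.zero[OF additive_left]

lemma scale_left: "f (int_scale n x) y = of_int n * f x y"
  using additive_int_scale[OF additive_left, of n x y] by simp

lemma scale_right: "f x (int_scale n y) = of_int n * f x y"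
  using additive_int_scale[OF additive_right, of x n y] by simp

text \<open>Otherwise a large multiple of \<open>x\<close> of suitable sign, added to
  \<open>y\<close>, would make the form negative: the square of \<open>x\<close> contributes nothing
  and the cross term is linear.\<close>

lemma null_left:
  assumes "f x x = 0"
  shows "f x y = 0"
proof (rule ccontr)
  assume neq: "f x y \<noteq> 0"
  obtain N :: nat where N: "f y y < of_nat N * \<bar>f x y\<bar>"
    using neq reals_Archimedean3[of "\<bar>f x y\<bar>"] by auto
  define n where "n = (if f x y < 0 then int N else - int N)"
  have "f (y + int_scale n x) (y + int_scale n x) = f y y - 2 * (of_nat N * \<bar>f x y\<bar>)"
    by (simp add: add_left add_right scale_left scale_right sym[of y x] n_def assms)
  moreover have "0 \<le> f y y" by (rule nonneg)
  ultimately show False using N nonneg[of "y + int_scale n x"] by linarith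
qed

lemma null_right: "f y y = 0 \<Longrightarrow> f x y = 0"
  using null_left sym by metis

lemma null_add: "f x x = 0 \<Longrightarrow> f y y = 0 \<Longrightarrow> f (x + y) (x + y) = 0"
  by (simp add: add_left null_left)

lemma null_diff: "f x x = 0 \<Longrightarrow> f y y = 0 \<Longrightarrow> f (x - y) (x - y) = 0"
  by (simp add: diff_left null_left)

lemma null_scale: "f x x = 0 \<Longrightarrow> f (int_scale n x) (int_scale n x) = 0"
  by (simp add: scale_left null_left)

lemma null_scaleD: "f (int_scale n x) (int_scale n x) = 0 \<Longrightarrow> n \<noteq> 0 \<Longrightarrow> f x x = 0"
  by (simp add: scale_left scale_right)

lemma null_diff_both: "f y y = 0 \<Longrightarrow> f (x - y) (x - y) = f x x"
  using null_left[of y x] null_right[of y x] by (simp add: diff_left diff_right)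

text \<open>Size reduction: \<open>k\<close> rounds the coefficient of the projection of
  \<open>x\<close> onto \<open>b\<close>.\<close>

lemma reduce:
  assumes "f b b > 0"
  obtains k where "\<bar>f (x - int_scale k b) b\<bar> \<le> f b b / 2"
proof -
  define k where "k = round (f x b / f b b)"
  have "\<bar>of_int k - f x b / f b b\<bar> \<le> 1/2" unfolding k_def by (rule of_int_round_abs_le)
  then have "\<bar>of_int k - f x b / f b b\<bar> * f b b \<le> 1/2 * f b b"
    using assms by (intro mult_right_mono) auto
  moreover have "\<bar>of_int k - f x b / f b b\<bar> * f b b = \<bar>(of_int k - f x b / f b b) * f b b\<bar>"
    using assms by (simp add: abs_mult)
  moreover have "(of_int k - f x b / f b b) * f b b = - f (x - int_scale k b) b"
    using assms by (simp add: diff_left scale_left field_simps)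
  ultimately show ?thesis using that[of k] by simp
qed

text \<open>The optimal real multiple of \<open>y\<close> is replaced by a rational approximation. A
  violation grows with the square of \<open>N\<close> when \<open>x\<close> is multiplied by
  \<open>N\<close>, while reduction modulo \<open>y\<close> leaves an error of at most
  \<open>f y y / 4\<close>.\<close>

lemma cauchy_schwarz: "(f x y)\<^sup>2 \<le> f x x * f y y"
proof (cases "f y y = 0")
  case True
  then show ?thesis by (simp add: null_right)
next
  case False
  then have pos: "f y y > 0" using nonneg[of y] by simp
  show ?thesis
  proof (rule ccontr)
    assume "\<not> ?thesis"
    then have "(f x y)\<^sup>2 / f y y - f x x > 0" (is "?D > 0")
      using pos by (simp add: field_simps)
    then obtain N :: nat where N: "f y y < of_nat N * ?D"
      using reals_Archimedean3 by blast
    then have N1: "N \<ge> 1" using pos by (cases N) auto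
    obtain k where k: "\<bar>f (int_scale (int N) x - int_scale k y) y\<bar> \<le> f y y / 2"
      using reduce[OF pos] by blast
    let ?z = "int_scale (int N) x - int_scale k y"
    \<comment> \<open>Split \<open>?z\<close> along \<open>y\<close>: the orthogonal part ignores
      the subtracted multiple of \<open>y\<close> and contributes
      \<open>- (of_nat N)\<^sup>2 * ?D\<close>.\<close>
    have "f ?z ?z = (f ?z y)\<^sup>2 / f y y - (of_nat N)\<^sup>2 * ?D"
      using pos by (simp add: diff_left diff_right scale_left scale_right sym[of y x] field_simps power2_eq_square)
    moreover have "(f ?z y)\<^sup>2 / f y y \<le> (f y y / 2)\<^sup>2 / f y y"
      using k pos by (intro divide_right_mono) (auto simp: abs_le_square_iff[symmetric])
    moreover have "(f y y / 2)\<^sup>2 / f y y = f y y / 4"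
      using pos by (simp add: power2_eq_square)
    moreover have "(of_nat N)\<^sup>2 * ?D \<ge> of_nat N * ?D"
      using N1 \<open>?D > 0\<close> by (intro mult_right_mono) (auto simp: power2_eq_square)
    ultimately have "f ?z ?z < 0" using N pos by linarith
    then show False using nonneg[of ?z] by simp
  qed
qed

lemma abs_le_norms: "\<bar>f x y\<bar> \<le> sqrt (f x x) * sqrt (f y y)"
  using real_sqrt_le_mono[OF cauchy_schwarz[of x y]] by (simp add: real_sqrt_mult)

lemma norm_add: "sqrt (f (x + y) (x + y)) \<le> sqrt (f x x) + sqrt (f y y)"
proof (rule real_le_lsqrt)
  have "f (x + y) (x + y) = f x x + 2 * f x y + f y y"
    by (simp add: add_left add_right sym[of y x])
  also have "\<dots> \<le> f x x + 2 * (sqrt (f x x) * sqrt (f y y)) + f y y"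
    using abs_le_norms[of x y] by simp
  also have "\<dots> = (sqrt (f x x) + sqrt (f y y))\<^sup>2"
    by (simp add: power2_sum nonneg)
  finally show "f (x + y) (x + y) \<le> (sqrt (f x x) + sqrt (f y y))\<^sup>2" .
qed (simp add: nonneg)

lemma norm_scale: "sqrt (f (int_scale n x) (int_scale n x)) = \<bar>of_int n\<bar> * sqrt (f x x)"
  by (simp add: scale_left scale_right real_sqrt_mult flip: mult.assoc)

lemma norm_lincomb:
  "sqrt (f (lincomb m k b) (lincomb m k b)) \<le> (\<Sum>i<m. \<bar>of_int (k i)\<bar> * sqrt (f (b i) (b i)))"
proof (induction m)
  case 0
  then show ?case by (simp add: lincomb_def zero_left)
next
  case (Suc m)
  have "sqrt (f (lincomb (Suc m) k b) (lincomb (Suc m) k b))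
    \<le> sqrt (f (lincomb m k b) (lincomb m k b)) + \<bar>of_int (k m)\<bar> * sqrt (f (b m) (b m))"
    using norm_add[of "lincomb m k b" "int_scale (k m) (b m)"] by (simp add: norm_scale lincomb_def)
  with Suc show ?case by simp
qed

lemma schur_split: "f x x = schur f b x x + (f x b)\<^sup>2 / f b b"
  by (simp add: schur_def power2_eq_square)

context
  fixes b assumes pos: "f b b > 0"
begin

lemma psd_schur: "psd_form (schur f b)"
proof
  show "schur f b (x + y) z = schur f b x z + schur f b y z" for x y z
    by (simp add: schur_def add_left add_divide_distrib distrib_right)
  show "schur f b x y = schur f b y x" for x y
    by (simp add: schur_def sym[of x y])
  show "0 \<le> schur f b x x" for x
    using cauchy_schwarz[of x b] pos by (simp add: schur_def power2_eq_square field_simps)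
qed

lemma schur_le: "schur f b x x \<le> f x x"
  using pos schur_split[of x b] by (simp add: zero_le_divide_iff)

lemma schur_base: "schur f b b b = 0"
  using pos by (simp add: schur_def)

lemma schur_null: "f x x = 0 \<Longrightarrow> schur f b x x = 0"
  by (simp add: schur_def null_left)

lemma schur_shift: "schur f b (x - int_scale k b) (x - int_scale k b) = schur f b x x"
  using psd_form.null_diff_both[OF psd_schur] psd_form.null_scale[OF psd_schur] schur_base by blast

text \<open>Pythagoras: the component along \<open>b\<close> is at most half of \<open>b\<close>,
  hence the quarter.\<close>

lemma reduced_le:
  assumes "\<bar>f x b\<bar> \<le> f b b / 2"
  shows "f x x \<le> schur f b x x + f b b / 4"
proof -
  have "(f x b)\<^sup>2 / f b b \<le> (f b b / 2)\<^sup>2 / f b b"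
    using assms pos by (intro divide_right_mono) (auto simp: abs_le_square_iff[symmetric])
  also have "\<dots> = f b b / 4" using pos by (simp add: power2_eq_square)
  finally show ?thesis using schur_split[of x b] by simp
qed

lemma schur_lift:
  obtains k where "f (x - int_scale k b) (x - int_scale k b) \<le> schur f b x x + f b b / 4"
  using reduce[OF pos, of x] reduced_le schur_shift by metis

text \<open>Steinitz exchange: a relation expressing a nonzero multiple of the non-null
  \<open>b\<close> involves some generator \<open>e\<close>, which becomes redundant once
  \<open>b\<close> is null.\<close>

lemma rank_le_schur:
  assumes "rank_le f r"
  obtains r' where "r = Suc r'" "rank_le (schur f b) r'"
proof -
  obtain E where E: "finite E" "card E \<le> r"
    and gen: "\<And>x. \<exists>n k. n \<noteq> 0 \<and>
        (let z = int_scale n x - (\<Sum>e\<in>E. int_scale (k e) e) in f z z = 0)"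
    using assms unfolding rank_le_def by blast
  obtain n k where n: "n \<noteq> 0"
    and nb: "f (int_scale n b - (\<Sum>e\<in>E. int_scale (k e) e))
              (int_scale n b - (\<Sum>e\<in>E. int_scale (k e) e)) = 0"
    using gen[of b] by (auto simp: Let_def)
  have "\<exists>e\<in>E. k e \<noteq> 0"
  proof (rule ccontr)
    assume "\<not> ?thesis"
    then have "f (int_scale n b) (int_scale n b) = 0" using nb by simp
    then show False using n pos null_scaleD by force
  qed
  then obtain e where e: "e \<in> E" "k e \<noteq> 0" by blast
  interpret s: psd_form "schur f b" by (rule psd_schur)
  have "rank_le (schur f b) (r - 1)"
    unfolding rank_le_def
  proof (rule exI[of _ "E - {e}"], intro conjI allI)
    show "finite (E - {e})" "card (E - {e}) \<le> r - 1" using E e by auto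
    fix x
    obtain l j where l: "l \<noteq> 0"
      and lx: "f (int_scale l x - (\<Sum>e\<in>E. int_scale (j e) e))
              (int_scale l x - (\<Sum>e\<in>E. int_scale (j e) e)) = 0"
      using gen[of x] by (auto simp: Let_def)
    let ?z = "int_scale l x - (\<Sum>e\<in>E. int_scale (j e) e)"
    let ?w = "int_scale n b - (\<Sum>e\<in>E. int_scale (k e) e)"
    \<comment> \<open>Cross-multiplying the two relations by \<open>k e\<close> and
      \<open>j e\<close> cancels \<open>e\<close>; the remaining multiple of \<open>b\<close> is
      null for the Schur form.\<close>
    let ?N = "k e * l" and ?K = "\<lambda>e'. k e * j e' - j e * k e'"
    have "int_scale ?N x - (\<Sum>e'\<in>E - {e}. int_scale (?K e') e')
        = int_scale (k e) ?z - int_scale (j e) ?w + int_scale (j e * n) b"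
      using E(1) e(1) by (simp add: sum.remove int_scale_diff_right int_scale_add_right
          int_scale_diff_left int_scale_sum_right sum_subtractf
          algebra_simps flip: int_scale_mult)
    moreover have "schur f b ?z ?z = 0" "schur f b ?w ?w = 0"
      using lx nb schur_null by auto
    ultimately have "let z = int_scale ?N x - (\<Sum>e'\<in>E - {e}. int_scale (?K e') e') in schur f b z z = 0"
      using s.null_add[OF s.null_diff[OF s.null_scale s.null_scale] s.null_scale[OF schur_base]]
      unfolding Let_def by presburger
    then show "\<exists>n k. n \<noteq> 0 \<and>
        (let z = int_scale n x - (\<Sum>e\<in>E - {e}. int_scale (k e) e) in schur f b z z = 0)"
      using l e by (intro exI[of _ ?N] exI[of _ ?K] conjI) auto
  qed
  moreover have "r \<noteq> 0" using E e(1) by (metis card_0_eq emptyE le_zero_eq)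
  ultimately show ?thesis using that[of "r - 1"] by simp
qed

end

end

section \<open>Discreteness modulo null vectors\<close>

locale lattice_form = psd_form f for f :: "'b::ab_group_add \<Rightarrow> 'b \<Rightarrow> real" +
  assumes discrete: "\<exists>S. finite S \<and> (\<forall>x. f x x \<le> R \<longrightarrow> (\<exists>s\<in>S. f (x - s) (x - s) = 0))"
begin

context
  fixes b assumes pos: "f b b > 0"
begin

text \<open>A vector that is short for the Schur form becomes short for \<open>f\<close> after
  subtracting a multiple of \<open>b\<close>. Hence representatives for \<open>f\<close> at a radius
  enlarged by \<open>f b b / 4\<close> suffice.\<close>

lemma lattice_schur: "lattice_form (schur f b)"
proof -
  interpret s: psd_form "schur f b" by (rule psd_schur[OF pos])
  show ?thesis
  proof
    fix R
    obtain S where S: "finite S"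
      and fin: "\<And>x. f x x \<le> R + f b b / 4 \<Longrightarrow> \<exists>s\<in>S. f (x - s) (x - s) = 0"
      using discrete[of "R + f b b / 4"] by blast
    show "\<exists>S. finite S \<and> (\<forall>x. schur f b x x \<le> R \<longrightarrow> (\<exists>s\<in>S. schur f b (x - s) (x - s) = 0))"
    proof (intro exI conjI allI impI)
      fix x assume x: "schur f b x x \<le> R"
      obtain k where "f (x - int_scale k b) (x - int_scale k b) \<le> schur f b x x + f b b / 4"
        using schur_lift[OF pos] by blast
      with x fin[of "x - int_scale k b"] obtain s where s: "s \<in> S"
        "f (x - int_scale k b - s) (x - int_scale k b - s) = 0" by auto
      have "schur f b (x - int_scale k b - s + int_scale k b) (x - int_scale k b - s + int_scale k b) = 0"
        using s schur_null schur_base by (intro s.null_add s.null_scale) (auto simp: pos)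
      then show "\<exists>s\<in>S. schur f b (x - s) (x - s) = 0"
        using s by (intro bexI[of _ s]) (simp_all add: algebra_simps)
    qed (rule S)
  qed
qed

text \<open>Pigeonhole on the multiples of \<open>y\<close> reduced modulo \<open>b\<close>.\<close>

lemma schur_null_rational:
  assumes y: "schur f b y y = 0"
  obtains n k where "n \<noteq> 0" "f (int_scale n y - int_scale k b) (int_scale n y - int_scale k b) = 0"
proof -
  interpret s: psd_form "schur f b" by (rule psd_schur[OF pos])
  have "\<exists>k. f (int_scale (int n) y - int_scale k b) (int_scale (int n) y - int_scale k b) \<le> f b b / 4" for n
    using schur_lift[OF pos, of "int_scale (int n) y"] s.null_scale[OF y, of "int n"] by (metis add_0)
  then obtain k where k: "\<And>n. f (int_scale (int n) y - int_scale (k n) b) (int_scale (int n) y - int_scale (k n) b) \<le> f b b / 4"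
    by metis
  define z where "z n = int_scale (int n) y - int_scale (k n) b" for n
  obtain S where S: "finite S"
    and fin: "\<And>x. f x x \<le> f b b / 4 \<Longrightarrow> \<exists>s\<in>S. f (x - s) (x - s) = 0"
    using discrete[of "f b b / 4"] by blast
  have "\<exists>s\<in>S. f (z n - s) (z n - s) = 0" for n
    using k[of n] fin unfolding z_def by blast
  then obtain s where s: "\<And>n. s n \<in> S" "\<And>n. f (z n - s n) (z n - s n) = 0" by metis
  have "range s \<subseteq> S" using s by blast
  then have "finite (range s)" using S finite_subset by blast
  then have "\<not> inj s" using finite_imageD[of s UNIV] by auto
  then obtain m n where mn: "s m = s n" "m \<noteq> n" by (auto simp: inj_def)
  have "f ((z m - s m) - (z n - s n)) ((z m - s m) - (z n - s n)) = 0"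
    by (rule null_diff[OF s(2) s(2)])
  moreover have "(z m - s m) - (z n - s n)
      = int_scale (int m - int n) y - int_scale (k m - k n) b"
    using mn by (simp add: z_def int_scale_diff_left algebra_simps)
  ultimately show ?thesis using that[of "int m - int n" "k m - k n"] mn by simp
qed

text \<open>Dividing out a kernel vector creates null vectors only inside the kernel. A nonzero
  multiple of \<open>y\<close> agrees with a multiple of \<open>b\<close> up to an
  \<open>f\<close>-null vector, so \<open>h\<close> kills it, and torsion-freeness removes the
  multiple.\<close>

lemma schur_null_kernel:
  assumes "torsion_free_group TYPE('a::ab_group_add)" "additive (h :: 'b \<Rightarrow> 'a)" "h b = 0"
    and null: "\<And>x. f x x = 0 \<Longrightarrow> h x = 0" and y: "schur f b y y = 0"
  shows "h y = 0"
proof -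
  obtain n k where n: "n \<noteq> 0"
    and "f (int_scale n y - int_scale k b) (int_scale n y - int_scale k b) = 0"
    using schur_null_rational[OF y] by blast
  then have "int_scale n (h y) = 0"
    using null[of "int_scale n y - int_scale k b"] assms(2,3)
    by (simp add: additive.diff additive_int_scale int_scale_zero_right)
  then show ?thesis using torsion_free_int_scale assms(1) n by blast
qed

end

text \<open>Up to null vectors only finitely many elements have value at most \<open>f x x\<close>;
  a minimum over their non-null representatives \<open>T\<close> is also below all longer
  vectors.\<close>

lemma shortest:
  assumes "f x x \<noteq> 0"
  obtains b where "f b b > 0" "\<And>y. f y y \<noteq> 0 \<Longrightarrow> f b b \<le> f y y"
proof -
  obtain S where S: "finite S"
    and fin: "\<And>y. f y y \<le> f x x \<Longrightarrow> \<exists>s\<in>S. f (y - s) (y - s) = 0"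
    using discrete[of "f x x"] by blast
  define T where "T = {s\<in>S. f s s \<noteq> 0}"
  have T: "\<exists>s\<in>T. f s s = f y y" if y: "f y y \<noteq> 0" "f y y \<le> f x x" for y
  proof -
    obtain s where s: "s \<in> S" "f (y - s) (y - s) = 0" using fin[OF y(2)] by blast
    then have "f s s = f y y" using null_diff_both[of "y - s" y] by simp
    with s(1) y(1) show ?thesis unfolding T_def by force
  qed
  have T': "finite T" "T \<noteq> {}"
    using S T[OF assms order_refl] by (simp add: T_def, blast)
  define b where "b = arg_min_on (\<lambda>s. f s s) T"
  have b: "b \<in> T" unfolding b_def by (rule arg_min_if_finite(1)[OF T'])
  have least: "f b b \<le> f y y" if "y \<in> T" for y
    using arg_min_least[OF T' that, of "\<lambda>s. f s s"] by (simp add: b_def)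
  have "f b b > 0" using b nonneg[of b] unfolding T_def by simp
  moreover have "f b b \<le> f y y" if "f y y \<noteq> 0" for y
  proof (cases "f y y \<le> f x x")
    case True
    from T[OF that True] least show ?thesis by metis
  next
    case False
    from T[OF assms order_refl] obtain s where "s \<in> T" "f s s = f x x" by blast
    with least[of s] False show ?thesis by linarith
  qed
  ultimately show ?thesis using that by blast
qed

end

text \<open>Induction on the rank: take a shortest non-null \<open>b\<close> and lift a reduced
  basis of its Schur complement by size reduction. The final bound also gives independence, since it
  forces the coefficients of a null combination to vanish.\<close>

lemma reduced_basis:
  assumes "lattice_form f" "rank_le f r"
  shows "\<exists>m b. m \<le> r \<and> (\<forall>i<m. f (b i) (b i) > 0) \<and>
     (\<forall>x. \<exists>k. f (x - lincomb m k b) (x - lincomb m k b) = 0) \<and>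
     (\<forall>k. (\<Sum>i<m. \<bar>of_int (k i)\<bar> * sqrt (f (b i) (b i)))
        \<le> (2 ^ m - 1) * sqrt (f (lincomb m k b) (lincomb m k b)))"
  using assms
proof (induction r arbitrary: f rule: less_induct)
  case (less r)
  interpret lattice_form f by (rule less.prems)
  show ?case
  proof (cases "\<forall>x. f x x = 0")
    case True
    then show ?thesis by (intro exI[of _ 0]) simp
  next
    case False
    then obtain b where pos: "f b b > 0" and min: "\<And>y. f y y \<noteq> 0 \<Longrightarrow> f b b \<le> f y y"
      using shortest by blast
    obtain r' where r': "r = Suc r'" "rank_le (schur f b) r'"
      using rank_le_schur[OF pos less.prems(2)] by blast
    let ?g = "schur f b"
    interpret s: lattice_form ?g by (rule lattice_schur[OF pos])
    obtain m c where m: "m \<le> r'" and cpos: "\<And>i. i < m \<Longrightarrow> ?g (c i) (c i) > 0"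
      and cgen: "\<And>x. \<exists>k. ?g (x - lincomb m k c) (x - lincomb m k c) = 0"
      and cbound: "\<And>k. (\<Sum>i<m. \<bar>of_int (k i)\<bar> * sqrt (?g (c i) (c i)))
          \<le> (2 ^ m - 1) * sqrt (?g (lincomb m k c) (lincomb m k c))"
      using less.IH[of r', OF _ lattice_schur[OF pos] r'(2)] r'(1) by auto
    obtain j where j: "\<And>i. \<bar>f (c i - int_scale (j i) b) b\<bar> \<le> f b b / 2"
    proof -
      have "\<exists>j. \<bar>f (c i - int_scale j b) b\<bar> \<le> f b b / 2" for i
        using reduce[OF pos, of "c i"] by blast
      then show ?thesis using that by metis
    qed
    define a where "a i = c i - int_scale (j i) b" for i
    \<comment> \<open>\<open>b\<close> takes the last index, so sums over the first \<open>m\<close>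
      indices involve only the lifts \<open>a\<close>.\<close>
    define B where "B = a(m := b)"
    have ga: "?g (a i) (a i) = ?g (c i) (c i)" for i
      by (simp add: a_def schur_shift[OF pos])
    have jb: "lincomb m k a = lincomb m k c - int_scale (\<Sum>i<m. k i * j i) b" for k
      by (simp add: lincomb_def a_def int_scale_diff_right sum_subtractf int_scale_sum_left int_scale_mult)
    have lB: "lincomb (Suc m) k B = lincomb m k a + int_scale (k m) b" for k
      by (simp add: lincomb_def B_def)
    have fa_ge: "f b b \<le> f (a i) (a i)" if "i < m" for i
      using cpos[OF that] schur_le[OF pos, of "a i"] ga[of i] by (intro min) auto
    \<comment> \<open>As \<open>b\<close> is shortest, \<open>f b b / 4\<close> is at most a quarter
      of \<open>f (a i) (a i)\<close>. This gives the factor 4/3 for squared lengths, weakened to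
      its square to keep the root rational.\<close>
    have fa_le: "sqrt (f (a i) (a i)) \<le> 4/3 * sqrt (?g (c i) (c i))" if "i < m" for i
    proof -
      have "f (a i) (a i) \<le> ?g (c i) (c i) + f b b / 4"
        using reduced_le[OF pos, of "a i"] j[of i] ga[of i] by (simp add: a_def)
      with fa_ge[OF that] cpos[OF that]
      have "f (a i) (a i) \<le> (4/3)\<^sup>2 * ?g (c i) (c i)" by (simp add: power2_eq_square)
      from real_sqrt_le_mono[OF this] show ?thesis by (simp add: real_sqrt_mult)
    qed
    have bound: "(\<Sum>i<Suc m. \<bar>of_int (k i)\<bar> * sqrt (f (B i) (B i)))
        \<le> (2 ^ Suc m - 1) * sqrt (f (lincomb (Suc m) k B) (lincomb (Suc m) k B))" for k
    proof -
      define x where "x = lincomb (Suc m) k B"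
      define T where "T = (\<Sum>i<m. \<bar>of_int (k i)\<bar> * sqrt (f (a i) (a i)))"
      have "lincomb m k c = x - int_scale (k m - (\<Sum>i<m. k i * j i)) b"
        by (simp add: x_def lB jb int_scale_diff_left)
      then have gx: "?g (lincomb m k c) (lincomb m k c) = ?g x x"
        by (simp add: schur_shift[OF pos])
      have "T \<le> (\<Sum>i<m. \<bar>of_int (k i)\<bar> * (4/3 * sqrt (?g (c i) (c i))))"
        unfolding T_def by (intro sum_mono mult_left_mono fa_le) auto
      also have "\<dots> = 4/3 * (\<Sum>i<m. \<bar>of_int (k i)\<bar> * sqrt (?g (c i) (c i)))"
        by (simp add: sum_distrib_left mult_ac)
      also have "\<dots> \<le> 4/3 * ((2 ^ m - 1) * sqrt (?g x x))"
        using cbound[of k] gx by simp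
      also have "\<dots> \<le> 4/3 * ((2 ^ m - 1) * sqrt (f x x))"
        using schur_le[OF pos, of x] by (intro mult_left_mono) auto
      finally have T: "T \<le> 4/3 * ((2 ^ m - 1) * sqrt (f x x))" .
      have fab: "\<bar>f (lincomb m k a) b\<bar> \<le> (\<Sum>i<m. \<bar>of_int (k i)\<bar> * (f b b / 2))"
      proof -
        have "f (lincomb m k a) b = (\<Sum>i<m. of_int (k i) * f (a i) b)"
          by (simp add: lincomb_def additive.sum[OF additive_left] scale_left)
        also have "\<bar>\<dots>\<bar> \<le> (\<Sum>i<m. \<bar>of_int (k i) * f (a i) b\<bar>)" by (rule sum_abs)
        also have "\<dots> \<le> (\<Sum>i<m. \<bar>of_int (k i)\<bar> * (f b b / 2))"
          using j by (intro sum_mono) (simp only: abs_mult a_def, intro mult_left_mono, auto)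
        finally show ?thesis .
      qed
      define s where "s = sqrt (f b b)"
      have s: "s > 0" "f b b = s * s" using pos by (simp_all add: s_def)
      \<comment> \<open>Pairing with \<open>b\<close> isolates the last coefficient. Cauchy-Schwarz
        and size reduction bound the other two terms, and one factor \<open>s\<close>
        cancels.\<close>
      have "f x b = f (lincomb m k a) b + of_int (k m) * f b b"
        by (simp add: x_def lB add_left scale_left)
      then have "of_int (k m) * (s * s) = f x b - f (lincomb m k a) b" by (simp only: s(2))
      then have "\<bar>of_int (k m) * (s * s)\<bar> \<le> \<bar>f x b\<bar> + \<bar>f (lincomb m k a) b\<bar>" by linarith
      moreover have "\<bar>of_int (k m) * (s * s)\<bar> = \<bar>of_int (k m)\<bar> * (s * s)"
        using s(1) by (simp add: abs_mult)
      ultimately have "\<bar>of_int (k m)\<bar> * (s * s) \<le> \<bar>f x b\<bar> + \<bar>f (lincomb m k a) b\<bar>" by linarith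
      also have "\<dots> \<le> sqrt (f x x) * s + (\<Sum>i<m. \<bar>of_int (k i)\<bar> * (s * s / 2))"
        using abs_le_norms[of x b, folded s_def] fab[unfolded s(2)] by linarith
      also have "\<dots> = (sqrt (f x x) + (\<Sum>i<m. \<bar>of_int (k i)\<bar> * s) / 2) * s"
        by (simp add: distrib_right sum_distrib_right sum_divide_distrib mult.assoc)
      finally have "\<bar>of_int (k m)\<bar> * s \<le> sqrt (f x x) + (\<Sum>i<m. \<bar>of_int (k i)\<bar> * s) / 2"
        using mult_right_le_imp_le[OF _ s(1)] by (simp only: mult.assoc)
      also have "(\<Sum>i<m. \<bar>of_int (k i)\<bar> * s) \<le> T"
        unfolding T_def s_def using fa_ge by (intro sum_mono mult_left_mono) auto
      finally have km: "\<bar>of_int (k m)\<bar> * s \<le> sqrt (f x x) + T / 2" by simp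
      have "(\<Sum>i<Suc m. \<bar>of_int (k i)\<bar> * sqrt (f (B i) (B i))) = T + \<bar>of_int (k m)\<bar> * s"
        by (simp add: B_def T_def s_def)
      \<comment> \<open>The total is at most \<open>3/2 * T + sqrt (f x x)\<close>; since
        \<open>3/2 * 4/3 = 2\<close>, the factor \<open>2 ^ m - 1\<close> becomes
        \<open>2 * (2 ^ m - 1) + 1\<close>.\<close>
      also have "\<dots> \<le> (2 ^ Suc m - 1) * sqrt (f x x)"
        using T km by (simp add: algebra_simps)
      finally show ?thesis by (simp only: x_def)
    qed
    have gen: "\<exists>k. f (x - lincomb (Suc m) k B) (x - lincomb (Suc m) k B) = 0" for x
    proof -
      obtain k where k: "?g (x - lincomb m k c) (x - lincomb m k c) = 0" using cgen by blast
      let ?y = "x - lincomb m k c"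
      obtain l where l: "f (?y - int_scale l b) (?y - int_scale l b) \<le> f b b / 4"
        using schur_lift[OF pos, of ?y] k by auto
      \<comment> \<open>A vector with at most a quarter of the squared length of the shortest
        non-null one must be null.\<close>
      then have null: "f (?y - int_scale l b) (?y - int_scale l b) = 0"
        using min[of "?y - int_scale l b"] pos by (cases "f (?y - int_scale l b) (?y - int_scale l b) = 0") auto
      \<comment> \<open>The last coefficient also restores the multiples of \<open>b\<close> removed
        from the \<open>c i\<close>.\<close>
      define k' where "k' = k(m := l + (\<Sum>i<m. k i * j i))"
      have "lincomb m k' a = lincomb m k a" by (rule lincomb_cong) (simp add: k'_def)
      then have "x - lincomb (Suc m) k' B = ?y - int_scale l b"
        by (simp add: lB jb k'_def int_scale_add_left algebra_simps)
      with null show ?thesis by metis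
    qed
    have Bpos: "f (B i) (B i) > 0" if "i < Suc m" for i
    proof (cases "i = m")
      case False
      with that fa_ge[of i] pos show ?thesis by (simp add: B_def)
    qed (simp add: B_def pos)
    show ?thesis
    proof (rule exI[of _ "Suc m"], rule exI[of _ B], intro conjI allI impI)
      show "Suc m \<le> r" using m r'(1) by simp
    qed (rule Bpos gen bound, assumption?)+
  qed
qed

text \<open>With \<open>U\<close> always true the conclusion says that the null space of \<open>g\<close> is the whole kernel
  of \<open>h\<close>.\<close>

lemma absorb_kernel:
  fixes h :: "'b::ab_group_add \<Rightarrow> 'a::ab_group_add"
  assumes tf: "torsion_free_group TYPE('a)" and add: "additive h"
    and "lattice_form f" "rank_le f r" "\<And>x. f x x = 0 \<Longrightarrow> h x = 0"
  shows "\<exists>g. lattice_form g \<and> rank_le g r \<and> (\<forall>x. g x x = 0 \<longrightarrow> h x = 0) \<and>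
     (\<forall>x. h x = 0 \<longrightarrow> U (g x x) \<longrightarrow> g x x = 0) \<and> (\<forall>x. g x x \<le> f x x) \<and>
     (\<forall>C::real. (\<forall>s. U s \<longrightarrow> s \<le> C) \<longrightarrow> 0 \<le> C \<longrightarrow>
        (\<forall>x. \<exists>y. h y = h x \<and> f y y \<le> g x x + real r * C / 4))"
  using assms(3-)
proof (induction r arbitrary: f rule: less_induct)
  case (less r)
  interpret lattice_form f by (rule less.prems)
  show ?case
  proof (cases "\<forall>x. h x = 0 \<longrightarrow> U (f x x) \<longrightarrow> f x x = 0")
    case True
    then show ?thesis using less.prems by (intro exI[of _ f]) force
  next
    case False
    \<comment> \<open>Such a kernel vector is divided out, which lowers the rank and so drives the
      induction. Lifting back later subtracts only multiples of it, invisible to \<open>h\<close>,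
      at a cost of at most \<open>C / 4\<close>.\<close>
    then obtain b where b: "h b = 0" "U (f b b)" "f b b \<noteq> 0" by blast
    then have pos: "f b b > 0" using nonneg[of b] by simp
    obtain r' where r': "r = Suc r'" "rank_le (schur f b) r'"
      using rank_le_schur[OF pos less.prems(2)] by blast
    have ker: "h x = 0" if "schur f b x x = 0" for x
      using schur_null_kernel[OF pos tf add b(1) less.prems(3) that] .
    obtain g where g: "lattice_form g" "rank_le g r'" "\<forall>x. g x x = 0 \<longrightarrow> h x = 0"
      "\<forall>x. h x = 0 \<longrightarrow> U (g x x) \<longrightarrow> g x x = 0" "\<forall>x. g x x \<le> schur f b x x"
      and lift: "\<forall>C::real. (\<forall>s. U s \<longrightarrow> s \<le> C) \<longrightarrow> 0 \<le> C \<longrightarrow>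
        (\<forall>x. \<exists>y. h y = h x \<and> schur f b y y \<le> g x x + real r' * C / 4)"
      using less.IH[of r', OF _ lattice_schur[OF pos] r'(2) ker] r'(1) by auto
    have "rank_le g r" using g(2) r'(1) unfolding rank_le_def by (meson le_SucI)
    moreover have "g x x \<le> f x x" for x
      using g(5) schur_le[OF pos, of x] order_trans by blast
    moreover have "\<exists>y. h y = h x \<and> f y y \<le> g x x + real r * C / 4"
      if C: "\<forall>s. U s \<longrightarrow> s \<le> C" "0 \<le> C" for C :: real and x
    proof -
      obtain y where y: "h y = h x" "schur f b y y \<le> g x x + real r' * C / 4" using lift C by blast
      obtain k where k: "f (y - int_scale k b) (y - int_scale k b) \<le> schur f b y y + f b b / 4"
        using schur_lift[OF pos] by blast
      have "h (y - int_scale k b) = h x"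
        using y b add by (simp add: additive.diff additive_int_scale int_scale_zero_right)
      moreover have "f b b \<le> C" using C b by blast
      then have "f (y - int_scale k b) (y - int_scale k b) \<le> g x x + real r * C / 4"
        using k y(2) r'(1) by (simp add: add_divide_distrib distrib_right)
      ultimately show ?thesis by blast
    qed
    ultimately show ?thesis using g by (intro exI[of _ g]) blast
  qed
qed

section \<open>Progressions and boxes\<close>

lemma finite_abs_le: "finite {k::int. \<bar>real_of_int k\<bar> \<le> r}"
proof (rule finite_subset)
  show "{k::int. \<bar>real_of_int k\<bar> \<le> r} \<subseteq> {- \<lfloor>r\<rfloor>..\<lfloor>r\<rfloor>}"
    by (auto simp: le_floor_iff abs_le_iff minus_le_iff)
qed simp

lemma card_abs_le:
  assumes "0 \<le> r"
  shows "real (card {k::int. \<bar>real_of_int k\<bar> \<le> r}) = 2 * of_int \<lfloor>r\<rfloor> + 1"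
proof -
  have "{k::int. \<bar>real_of_int k\<bar> \<le> r} = {- \<lfloor>r\<rfloor>..\<lfloor>r\<rfloor>}"
    by (auto simp: le_floor_iff abs_le_iff minus_le_iff)
  moreover have "0 \<le> \<lfloor>r\<rfloor>" using assms by simp
  ultimately show ?thesis by simp
qed

lemma gap_sum_lincomb: "gap_sum P k = lincomb (gap_rank P) k (gap_steps P)"
  by (simp add: gap_sum_def lincomb_def)

lemma additive_gap_sum: "additive (gap_sum P)"
  by (simp add: additive_def gap_sum_def int_scale_add_left sum.distrib)

lemma gap_dilate_simps [simp]:
  "gap_dims (gap_dilate t P) i = t * gap_dims P i"
  "gap_steps (gap_dilate t P) = gap_steps P"
  "gap_rank (gap_dilate t P) = gap_rank P"
  by (simp_all add: gap_dilate_def)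

lemma gap_sum_dilate [simp]: "gap_sum (gap_dilate t P) = gap_sum P"
  by (simp add: gap_sum_def fun_eq_iff)

text \<open>\<open>gap_sum\<close> reads only indices below the rank, so arbitrary coefficient
  functions can replace the extensional ones in \<open>gap_box\<close>.\<close>

lemma mem_gap_image_iff:
  "x \<in> gap_image P \<longleftrightarrow> (\<exists>k. (\<forall>i<gap_rank P. \<bar>real_of_int (k i)\<bar> \<le> gap_dims P i) \<and> x = gap_sum P k)"
proof
  assume "\<exists>k. (\<forall>i<gap_rank P. \<bar>real_of_int (k i)\<bar> \<le> gap_dims P i) \<and> x = gap_sum P k"
  then obtain k where k: "\<forall>i<gap_rank P. \<bar>real_of_int (k i)\<bar> \<le> gap_dims P i" "x = gap_sum P k" by blast
  then have "restrict k {..<gap_rank P} \<in> gap_box P" by (auto simp: gap_box_def)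
  moreover have "gap_sum P (restrict k {..<gap_rank P}) = x" using k by (simp add: gap_sum_def)
  ultimately show "x \<in> gap_image P" unfolding gap_image_def by blast
qed (auto simp: gap_image_def gap_box_def PiE_iff)

lemma finite_gap_box: "finite (gap_box P)"
  unfolding gap_box_def by (intro finite_PiE finite_abs_le) simp

lemma finite_gap_image: "finite (gap_image P)"
  by (simp add: gap_image_def finite_gap_box)

lemma gap_size_le_box: "gap_size P \<le> card (gap_box P)"
  by (simp add: gap_size_def gap_image_def card_image_le finite_gap_box)

lemma gap_size_mono: "gap_image P \<subseteq> gap_image Q \<Longrightarrow> gap_size P \<le> gap_size Q"
  by (simp add: gap_size_def card_mono finite_gap_image)

lemma gap_size_proper: "gap_proper P \<Longrightarrow> gap_size P = card (gap_box P)"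
  by (simp add: gap_proper_def gap_size_def gap_image_def card_image)

lemma card_gap_box:
  assumes "\<And>i. i < gap_rank P \<Longrightarrow> 0 \<le> gap_dims P i"
  shows "real (card (gap_box P)) = (\<Prod>i<gap_rank P. 2 * of_int \<lfloor>gap_dims P i\<rfloor> + 1)"
  using assms by (simp add: gap_box_def card_PiE card_abs_le)

lemma gap_box_dilate_mono:
  assumes "s \<le> t" "symmetric_gap P"
  shows "gap_box (gap_dilate s P) \<subseteq> gap_box (gap_dilate t P)"
proof (simp only: gap_box_def gap_dilate_simps, rule PiE_mono)
  fix i assume "i \<in> {..<gap_rank P}"
  then have "s * gap_dims P i \<le> t * gap_dims P i"
    using assms by (intro mult_right_mono) (auto simp: symmetric_gap_def intro: less_imp_le)
  then show "{k. \<bar>real_of_int k\<bar> \<le> s * gap_dims P i}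
      \<subseteq> {k. \<bar>real_of_int k\<bar> \<le> t * gap_dims P i}" by auto
qed

lemma gap_dilate_one: "gap_image (gap_dilate 1 P) = gap_image P" "gap_box (gap_dilate 1 P) = gap_box P"
  by (simp_all add: gap_image_def gap_box_def)

lemma gap_image_dilate_mono:
  "s \<le> t \<Longrightarrow> symmetric_gap P \<Longrightarrow> gap_image (gap_dilate s P) \<subseteq> gap_image (gap_dilate t P)"
  by (simp add: gap_image_def image_mono gap_box_dilate_mono)

lemma gap_t_proper_mono:
  "s \<le> t \<Longrightarrow> symmetric_gap P \<Longrightarrow> gap_t_proper t P \<Longrightarrow> gap_t_proper s P"
  unfolding gap_t_proper_def gap_proper_def
  using inj_on_subset gap_box_dilate_mono by (metis gap_sum_dilate)

lemma gap_t_proper_iff: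
  "gap_t_proper t P \<longleftrightarrow> (\<forall>k l. (\<forall>i<gap_rank P. \<bar>real_of_int (k i)\<bar> \<le> t * gap_dims P i) \<longrightarrow>
     (\<forall>i<gap_rank P. \<bar>real_of_int (l i)\<bar> \<le> t * gap_dims P i) \<longrightarrow> gap_sum P k = gap_sum P l \<longrightarrow>
     (\<forall>i<gap_rank P. k i = l i))" (is "_ \<longleftrightarrow> ?R")
proof
  assume L: "gap_t_proper t P"
  show ?R
  proof (intro allI impI)
    fix k l i
    assume kl: "\<forall>i<gap_rank P. \<bar>real_of_int (k i)\<bar> \<le> t * gap_dims P i"
      "\<forall>i<gap_rank P. \<bar>real_of_int (l i)\<bar> \<le> t * gap_dims P i" "gap_sum P k = gap_sum P l"
      and i: "i < gap_rank P"
    let ?r = "\<lambda>k. restrict k {..<gap_rank P}"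
    have "?r k \<in> gap_box (gap_dilate t P)" "?r l \<in> gap_box (gap_dilate t P)"
      using kl by (auto simp: gap_box_def)
    moreover have "gap_sum P (?r k) = gap_sum P (?r l)" using kl by (simp add: gap_sum_def)
    ultimately have "?r k = ?r l"
      using L by (auto simp: gap_t_proper_def gap_proper_def dest: inj_onD)
    with i show "k i = l i" by (metis lessThan_iff restrict_apply')
  qed
next
  assume R: ?R
  show "gap_t_proper t P"
    unfolding gap_t_proper_def gap_proper_def
  proof (rule inj_onI)
    fix k l
    assume kl: "k \<in> gap_box (gap_dilate t P)" "l \<in> gap_box (gap_dilate t P)"
      "gap_sum (gap_dilate t P) k = gap_sum (gap_dilate t P) l"
    show "k = l"
    proof (rule PiE_ext)
      show "k \<in> (\<Pi>\<^sub>E i\<in>{..<gap_rank P}. UNIV)" "l \<in> (\<Pi>\<^sub>E i\<in>{..<gap_rank P}. UNIV)"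
        using kl by (auto simp: gap_box_def PiE_iff)
      fix i assume "i \<in> {..<gap_rank P}"
      then show "k i = l i" using R kl by (simp add: gap_box_def PiE_iff)
    qed
  qed
qed

section \<open>The Euclidean form attached to a box\<close>

definition box_form :: "(nat \<Rightarrow> real) \<Rightarrow> nat \<Rightarrow> (nat \<Rightarrow> int) \<Rightarrow> (nat \<Rightarrow> int) \<Rightarrow> real" where
  "box_form N d x y = (\<Sum>i<d. of_int (x i) * of_int (y i) / (N i)\<^sup>2)"

lemma box_form_sq: "box_form N d x x = (\<Sum>i<d. (of_int (x i) / N i)\<^sup>2)"
  by (simp add: box_form_def power2_eq_square)

lemma psd_box_form: "psd_form (box_form N d)"
proof
  show "box_form N d (x + y) z = box_form N d x z + box_form N d y z" for x y z
    by (simp add: box_form_def sum.distrib add_divide_distrib distrib_right)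
  show "box_form N d x y = box_form N d y x" for x y
    by (simp add: box_form_def mult.commute)
  show "0 \<le> box_form N d x x" for x
    by (simp add: box_form_sq sum_nonneg)
qed

lemma box_form_null:
  assumes "\<And>i. i < d \<Longrightarrow> 0 < N i" "box_form N d x x = 0" "i < d"
  shows "x i = 0"
proof -
  have "(of_int (x i) / N i)\<^sup>2 = 0"
    using assms(2,3) sum_nonneg_eq_0_iff[of "{..<d}" "\<lambda>i. (of_int (x i) / N i)\<^sup>2"]
    by (auto simp: box_form_sq)
  with assms(1)[OF assms(3)] show ?thesis by simp
qed

lemma coordinate_le_norm:
  fixes d :: nat
  assumes "\<And>i. i < d \<Longrightarrow> 0 < N i" "i < d"
  shows "\<bar>u i\<bar> \<le> N i * sqrt (\<Sum>i<d. (u i / N i)\<^sup>2)"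
proof -
  have "(u i / N i)\<^sup>2 \<le> (\<Sum>i<d. (u i / N i)\<^sup>2)"
    using assms(2) by (intro member_le_sum) auto
  then have "\<bar>u i / N i\<bar> \<le> sqrt (\<Sum>i<d. (u i / N i)\<^sup>2)" by (rule real_le_rsqrt[of "\<bar>_\<bar>", simplified])
  with assms(1)[OF assms(2)] show ?thesis by (simp add: field_simps abs_mult)
qed

lemma box_form_le:
  assumes "\<And>i. i < d \<Longrightarrow> 0 < N i" "\<And>i. i < d \<Longrightarrow> \<bar>real_of_int (x i)\<bar> \<le> s * N i"
  shows "box_form N d x x \<le> real d * s\<^sup>2"
proof -
  have "(of_int (x i) / N i)\<^sup>2 \<le> s\<^sup>2" if "i < d" for i
  proof -
    have "\<bar>of_int (x i) / N i\<bar> \<le> s" using assms[OF that] by (simp add: field_simps)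
    then show ?thesis by (metis abs_le_square_iff abs_ge_zero abs_of_nonneg order_trans)
  qed
  then have "box_form N d x x \<le> (\<Sum>i<d. s\<^sup>2)" unfolding box_form_sq by (intro sum_mono) auto
  then show ?thesis by simp
qed

lemma lattice_box_form:
  assumes N: "\<And>i. i < d \<Longrightarrow> 0 < N i"
  shows "lattice_form (box_form N d)"
proof -
  interpret psd_form "box_form N d" by (rule psd_box_form)
  show ?thesis
  proof
    fix R
    let ?S = "\<Pi>\<^sub>E i\<in>{..<d}. {k::int. \<bar>real_of_int k\<bar> \<le> N i * sqrt R}"
    show "\<exists>S. finite S \<and> (\<forall>x. box_form N d x x \<le> R \<longrightarrow>
        (\<exists>s\<in>S. box_form N d (x - s) (x - s) = 0))"
    proof (rule exI[of _ ?S], intro conjI allI impI)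
      show "finite ?S" by (intro finite_PiE finite_abs_le) simp
      fix x assume x: "box_form N d x x \<le> R"
      have "\<bar>real_of_int (x i)\<bar> \<le> N i * sqrt R" if "i < d" for i
      proof -
        have "\<bar>real_of_int (x i)\<bar> \<le> N i * sqrt (box_form N d x x)"
          using coordinate_le_norm[where u = "\<lambda>i. of_int (x i)", OF N that] unfolding box_form_sq .
        also have "\<dots> \<le> N i * sqrt R" using x N[OF that] by (intro mult_left_mono) auto
        finally show ?thesis .
      qed
      \<comment> \<open>Coordinates from \<open>d\<close> onward do not enter the form, so
        \<open>x\<close> and its restriction differ by a null vector.\<close>
      then have "restrict x {..<d} \<in> ?S" by auto
      moreover have "box_form N d (x - restrict x {..<d}) (x - restrict x {..<d}) = 0"
        by (simp add: box_form_def)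
      ultimately show "\<exists>s\<in>?S. box_form N d (x - s) (x - s) = 0" by blast
    qed
  qed
qed

lemma rank_le_box_form: "rank_le (box_form N d) d"
proof -
  define e :: "nat \<Rightarrow> nat \<Rightarrow> int" where "e j i = (if i = j then 1 else 0)" for j i
  \<comment> \<open>The coefficients in \<open>rank_le\<close> are indexed by the vectors
    themselves; this pairing returns \<open>x j\<close> at the unit vector
    \<open>e j\<close>.\<close>
  define k where "k x u = (\<Sum>j<d. u j * x j)" for x u :: "nat \<Rightarrow> int"
  have inj: "inj_on e {..<d}" by (rule inj_onI) (metis e_def zero_neq_one)
  have ke: "k x (e j) = x j" if "j < d" for x j
    using that by (simp add: k_def e_def if_distrib[of "\<lambda>u. u * _"] cong: if_cong)
  have "(x - (\<Sum>u\<in>e ` {..<d}. int_scale (k x u) u)) i = 0" if "i < d" for x i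
  proof -
    have "(\<Sum>u\<in>e ` {..<d}. int_scale (k x u) u) = (\<Sum>j<d. int_scale (x j) (e j))"
      using inj ke by (simp add: sum.reindex)
    then have "(\<Sum>u\<in>e ` {..<d}. int_scale (k x u) u) i = (\<Sum>j<d. int_scale (x j) (e j)) i" by simp
    also have "\<dots> = (\<Sum>j<d. x j * e j i)"
      using additive.sum[of "\<lambda>u. u i" "\<lambda>j. int_scale (x j) (e j)" "{..<d}"]
      by (simp add: additive_def)
    also have "\<dots> = x i" using that by (simp add: e_def if_distrib[of "\<lambda>u. _ * u"] cong: if_cong)
    finally show ?thesis by simp
  qed
  then have null: "box_form N d z z = 0" if "z = int_scale 1 x - (\<Sum>u\<in>e ` {..<d}. int_scale (k x u) u)" for x z
    using that by (simp add: box_form_def)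
  have gen: "\<exists>n k. n \<noteq> 0 \<and>
      (let z = int_scale n x - (\<Sum>u\<in>e ` {..<d}. int_scale (k u) u) in box_form N d z z = 0)" for x
    unfolding Let_def by (rule exI[of _ 1], rule exI[of _ "k x"]) (simp add: null)
  show ?thesis
    unfolding rank_le_def
    by (rule exI[of _ "e ` {..<d}"], intro conjI allI gen)
      (use card_image_le[of "{..<d}" e] in simp_all)
qed

text \<open>Write \<open>y\<close> as a vector orthogonal to \<open>b\<close> plus at most half of \<open>b\<close>; measuring the second
  part in the supremum norm loses only \<open>1/2\<close>, whatever the dimension.\<close>

lemma schur_box_coordinate:
  assumes N: "\<And>i. i < d \<Longrightarrow> 0 < N i" and pos: "box_form N d b b > 0"
    and b: "\<And>i. i < d \<Longrightarrow> \<bar>real_of_int (b i)\<bar> \<le> N i"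
    and y: "\<bar>box_form N d y b\<bar> \<le> box_form N d b b / 2" and i: "i < d"
  shows "\<bar>real_of_int (y i)\<bar> \<le> N i * (sqrt (schur (box_form N d) b y y) + 1/2)"
proof -
  define \<alpha> where "\<alpha> = box_form N d y b / box_form N d b b"
  have \<alpha>: "\<bar>\<alpha>\<bar> \<le> 1/2" using y pos by (simp add: \<alpha>_def field_simps)
  \<comment> \<open>The component of \<open>y\<close> orthogonal to \<open>b\<close>; its
    coordinates are real, hence the real tuple in \<open>coordinate_le_norm\<close>.\<close>
  let ?u = "\<lambda>i. of_int (y i) - \<alpha> * of_int (b i)"
  have "(\<Sum>i<d. (?u i / N i)\<^sup>2) = box_form N d y y - 2 * \<alpha> * box_form N d y b + \<alpha>\<^sup>2 * box_form N d b b"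
    by (simp add: box_form_def sum_distrib_left power_divide power2_diff add_divide_distrib
        diff_divide_distrib sum.distrib sum_subtractf power_mult_distrib)
      (simp add: power2_eq_square mult_ac)
  also have "\<dots> = schur (box_form N d) b y y"
    using pos by (simp add: schur_def \<alpha>_def power2_eq_square field_simps)
  finally have "\<bar>?u i\<bar> \<le> N i * sqrt (schur (box_form N d) b y y)"
    using coordinate_le_norm[where N = N and u = ?u, OF N i] by simp
  moreover have "\<bar>\<alpha> * of_int (b i)\<bar> \<le> 1/2 * N i"
    unfolding abs_mult using \<alpha> b[OF i] by (intro mult_mono) auto
  ultimately show ?thesis by (simp add: distrib_left)
qed

section \<open>Construction of the proper progression\<close>

text \<open>This compares the loss in the outer inclusion with the permitted dilation. The constant
  64 arises from \<open>8 ^ d * 4 ^ d * 2 ^ d\<close>.\<close>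

lemma dilation_factor_ge:
  assumes "0 < d"
  shows "8 * (real d)\<^sup>2 * 2 ^ d \<le> dilation_factor 64 d"
proof -
  have "real d < 2 ^ d" by (rule of_nat_less_two_power)
  then have "(real d)\<^sup>2 \<le> (2 ^ d)\<^sup>2" by (intro power_mono) auto
  also have "\<dots> = (4::real) ^ d" by (simp add: power_mult[symmetric] mult.commute[of d] power_mult)
  finally have d2: "(real d)\<^sup>2 \<le> 4 ^ d" .
  have "(8::real) ^ 1 \<le> 8 ^ d" using assms by (intro power_increasing) auto
  then have "8 * (real d)\<^sup>2 * 2 ^ d \<le> 8 ^ d * 4 ^ d * (2::real) ^ d"
    using d2 by (intro mult_mono) auto
  also have "\<dots> = 64 ^ d" by (simp add: power_mult_distrib[symmetric])
  also have "\<dots> = 64 powr real d" by (simp add: powr_realpow)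
  also have "\<dots> \<le> 64 powr (3 * real d / 2)" by (intro powr_mono) auto
  also have "\<dots> \<le> (64 * real d) powr (3 * real d / 2)" using assms by (intro powr_mono2) auto
  finally show ?thesis using assms by (simp add: dilation_factor_def)
qed

text \<open>The base of the \<open>m\<close>-th power is the loss per coordinate in the size
  comparison. Its factors \<open>t\<close> and \<open>2 ^ d\<close> are paid for by
  \<open>t powr (- real d)\<close> and the quadratic exponent, the remaining
  \<open>24 * D\<^sup>2\<close> by the logarithmic one.\<close>

lemma size_constant:
  fixes t D :: real
  assumes t: "1 \<le> t" and D: "D = real (max 1 d)" and m: "m \<le> d"
  shows "t powr (- real d) * 2 powr (- (real d)\<^sup>2 - 64 * real d * ln (real d + 1))
     * (3 * (8 * D\<^sup>2 * 2 ^ d * t)) ^ m \<le> 1"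
proof -
  have D1: "D \<ge> 1" by (simp add: D)
  have base: "1 \<le> 3 * (8 * D\<^sup>2 * 2 ^ d * t)"
  proof -
    have "1 * 1 * 1 \<le> D\<^sup>2 * 2 ^ d * t" using D1 t by (intro mult_mono one_le_power) auto
    then show ?thesis by simp
  qed
  have "24 * D\<^sup>2 \<le> 2 powr (64 * ln (real d + 1))" if "d \<noteq> 0"
  proof -
    have d1: "real d + 1 \<ge> 2" using that by simp
    have "24 * D\<^sup>2 \<le> 2 ^ 5 * (real d + 1)\<^sup>2"
      using that by (intro mult_mono power_mono) (auto simp: D)
    also have "\<dots> \<le> (real d + 1) ^ 5 * (real d + 1)\<^sup>2"
      using d1 by (intro mult_mono power_mono) auto
    also have "\<dots> = (real d + 1) ^ 7" by (simp flip: power_add)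
    also have "\<dots> = (real d + 1) powr 7" using powr_realpow[of "real d + 1" 7] by simp
    \<comment> \<open>\<open>ln 2\<close> is at least 1/2, so the exponent is at least 32.\<close>
    also have "\<dots> \<le> (real d + 1) powr (64 * ln 2)"
      using d1 ln_le_minus_one[of "1/2::real"] by (intro powr_mono) (auto simp: ln_div)
    also have "\<dots> = 2 powr (64 * ln (real d + 1))" using d1 by (simp add: powr_def mult_ac)
    finally show ?thesis .
  qed
  then have "(24 * D\<^sup>2) ^ d \<le> (2 powr (64 * ln (real d + 1))) ^ d"
    by (cases "d = 0") (simp, intro power_mono, simp_all)
  also have "\<dots> = 2 powr (64 * real d * ln (real d + 1))"
    by (simp add: powr_realpow[symmetric] powr_powr mult_ac)
  finally have main: "(24 * D\<^sup>2) ^ d \<le> 2 powr (64 * real d * ln (real d + 1))" .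
  have "(3 * (8 * D\<^sup>2 * 2 ^ d * t)) ^ m \<le> (3 * (8 * D\<^sup>2 * 2 ^ d * t)) ^ d"
    using base m by (intro power_increasing) auto
  also have "\<dots> = (24 * D\<^sup>2) ^ d * (2 ^ d) ^ d * t ^ d"
  proof -
    have "3 * (8 * D\<^sup>2 * 2 ^ d * t) = 24 * D\<^sup>2 * 2 ^ d * t" by simp
    then show ?thesis by (simp only: power_mult_distrib)
  qed
  also have "\<dots> \<le> 2 powr (64 * real d * ln (real d + 1)) * (2 ^ d) ^ d * t ^ d"
    using main t by (intro mult_right_mono) auto
  also have "(2 ^ d) ^ d = 2 powr ((real d)\<^sup>2)"
    by (simp add: powr_realpow[symmetric] powr_powr power2_eq_square)
  also have "t ^ d = t powr real d" using t by (simp add: powr_realpow)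
  finally have "(3 * (8 * D\<^sup>2 * 2 ^ d * t)) ^ m
      \<le> 2 powr (64 * real d * ln (real d + 1)) * 2 powr ((real d)\<^sup>2) * t powr real d" .
  then have "t powr (- real d) * 2 powr (- (real d)\<^sup>2 - 64 * real d * ln (real d + 1))
     * (3 * (8 * D\<^sup>2 * 2 ^ d * t)) ^ m
     \<le> t powr (- real d) * 2 powr (- (real d)\<^sup>2 - 64 * real d * ln (real d + 1))
     * (2 powr (64 * real d * ln (real d + 1)) * 2 powr ((real d)\<^sup>2) * t powr real d)"
    by (intro mult_left_mono) auto
  also have "\<dots> = t powr (- real d + real d) *
      2 powr ((- (real d)\<^sup>2 - 64 * real d * ln (real d + 1)) + (64 * real d * ln (real d + 1) + (real d)\<^sup>2))"
    by (simp only: powr_add mult_ac)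
  also have "\<dots> = 1" using t by simp
  finally show ?thesis .
qed

text \<open>The base form of the construction. If \<open>P\<close> is not \<open>1/2\<close>-proper, a relation inside the box
  itself is divided out first, which lowers the rank and costs the summand \<open>1/2\<close>.\<close>

lemma initial_form:
  fixes P :: "'a::ab_group_add gap"
  assumes tf: "torsion_free_group TYPE('a)" and symP: "symmetric_gap P"
  obtains f r where "lattice_form f" "rank_le f r" "r \<le> gap_rank P"
    "\<not> gap_t_proper (1/2) P \<longrightarrow> r < gap_rank P"
    "\<And>x. f x x = 0 \<Longrightarrow> gap_sum P x = 0"
    "\<And>x. f x x \<le> box_form (gap_dims P) (gap_rank P) x x"
    "\<And>x. \<exists>y. gap_sum P y = gap_sum P x \<and>
       (\<forall>i<gap_rank P. \<bar>real_of_int (y i)\<bar> \<le> gap_dims P i * (sqrt (f x x) + 1/2))"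
proof -
  define N where "N = gap_dims P"
  define d where "d = gap_rank P"
  have N: "\<And>i. i < d \<Longrightarrow> 0 < N i" using symP by (simp add: symmetric_gap_def N_def d_def)
  define f where "f = box_form N d"
  interpret lattice_form f unfolding f_def by (rule lattice_box_form[OF N])
  have rank: "rank_le f d" unfolding f_def by (rule rank_le_box_form)
  have null: "gap_sum P x = 0" if "f x x = 0" for x
    using that box_form_null[where N = N and d = d and x = x, OF N]
    unfolding f_def gap_sum_def d_def[symmetric] by simp
  show ?thesis
  proof (cases "gap_t_proper (1/2) P")
    case True
    show ?thesis
    proof (rule that[of f d])
      fix x
      show "\<exists>y. gap_sum P y = gap_sum P x \<and>
         (\<forall>i<gap_rank P. \<bar>real_of_int (y i)\<bar> \<le> gap_dims P i * (sqrt (f x x) + 1/2))"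
      proof (intro exI[of _ x] conjI allI impI refl)
        fix i assume "i < gap_rank P"
        then have i: "i < d" by (simp add: d_def)
        have "\<bar>real_of_int (x i)\<bar> \<le> N i * sqrt (f x x)"
          using coordinate_le_norm[where u = "\<lambda>i. of_int (x i)", OF N i]
          unfolding f_def box_form_sq .
        also have "\<dots> \<le> N i * (sqrt (f x x) + 1/2)" using N[OF i] by (intro mult_left_mono) auto
        finally show "\<bar>real_of_int (x i)\<bar> \<le> gap_dims P i * (sqrt (f x x) + 1/2)" by (simp add: N_def)
      qed
    qed (use True lattice_form_axioms rank null in \<open>simp_all add: f_def N_def d_def\<close>)
  next
    case False
    then obtain k l i where k: "\<forall>i<d. \<bar>real_of_int (k i)\<bar> \<le> 1/2 * N i"
      and l: "\<forall>i<d. \<bar>real_of_int (l i)\<bar> \<le> 1/2 * N i"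
      and eq: "gap_sum P k = gap_sum P l" and i: "i < d" "k i \<noteq> l i"
      unfolding gap_t_proper_iff N_def d_def by blast
    \<comment> \<open>Two colliding vectors in the half box differ by a relation in the full box, as
      \<open>schur_box_coordinate\<close> requires.\<close>
    define b where "b = k - l"
    have kb: "gap_sum P b = 0" using eq by (simp add: b_def additive.diff[OF additive_gap_sum])
    have bN: "\<bar>real_of_int (b i)\<bar> \<le> N i" if "i < d" for i
      using k[rule_format, OF that] l[rule_format, OF that] by (simp add: b_def)
    have "f b b \<noteq> 0" using box_form_null[where N = N and d = d and x = b and i = i, OF N] i
      unfolding f_def b_def by auto
    then have pos: "f b b > 0" using nonneg[of b] by simp
    obtain r where r: "d = Suc r" "rank_le (schur f b) r" using rank_le_schur[OF pos rank] by blast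
    show ?thesis
    proof (rule that[of "schur f b" r])
      show "lattice_form (schur f b)" by (rule lattice_schur[OF pos])
      show "gap_sum P x = 0" if "schur f b x x = 0" for x
        by (rule schur_null_kernel[OF pos tf additive_gap_sum kb null that])
      fix x
      obtain j where j: "\<bar>f (x - int_scale j b) b\<bar> \<le> f b b / 2" using reduce[OF pos] by blast
      show "\<exists>y. gap_sum P y = gap_sum P x \<and>
         (\<forall>i<gap_rank P. \<bar>real_of_int (y i)\<bar> \<le> gap_dims P i * (sqrt (schur f b x x) + 1/2))"
      proof (intro exI[of _ "x - int_scale j b"] conjI allI impI)
        show "gap_sum P (x - int_scale j b) = gap_sum P x"
          by (simp add: additive.diff[OF additive_gap_sum] additive_int_scale[OF additive_gap_sum]
              kb int_scale_zero_right)
        fix i assume "i < gap_rank P"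
        then have i: "i < d" by (simp add: d_def)
        have "\<bar>real_of_int ((x - int_scale j b) i)\<bar>
            \<le> N i * (sqrt (schur f b (x - int_scale j b) (x - int_scale j b)) + 1/2)"
          unfolding f_def
          by (rule schur_box_coordinate[OF N pos[unfolded f_def] bN j[unfolded f_def] i])
        then show "\<bar>real_of_int ((x - int_scale j b) i)\<bar>
            \<le> gap_dims P i * (sqrt (schur f b x x) + 1/2)"
          by (simp only: schur_shift[OF pos] N_def)
      qed
    qed (use r schur_le[OF pos] in \<open>simp_all add: f_def N_def d_def\<close>)
  qed
qed

text \<open>Three facts carry the proof. Kernel vectors of length at most \<open>c\<close> are null,
  which gives properness; lifts from \<open>g\<close> back to the box are cheap, which gives the
  inner inclusion; the reduced basis bounds coefficients by lengths, which gives the outer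
  one.\<close>

lemma approximation_exists:
  fixes P :: "'a::ab_group_add gap"
  assumes tf: "torsion_free_group TYPE('a)" and symP: "symmetric_gap P" and t: "1 \<le> t"
  obtains Q where "gap_rank Q \<le> gap_rank P"
    "\<not> gap_t_proper (1/2) P \<longrightarrow> gap_rank Q < gap_rank P" "proper_approximation 64 t P Q"
proof -
  define d where "d = gap_rank P"
  \<comment> \<open>The maximum with 1 keeps the denominators positive in rank zero.\<close>
  define D where "D = real (max 1 d)"
  have D1: "D \<ge> 1" and dD: "real d \<le> D" by (simp_all add: D_def)
  \<comment> \<open>With \<open>c\<^sup>2 * D = 1/4\<close>, at most \<open>d\<close> lifts, each
    costing a quarter of \<open>c\<^sup>2\<close>, add at most 1/16 in total.\<close>
  define c where "c = 1 / (2 * sqrt D)"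
  have c: "c > 0" using D1 by (simp add: c_def)
  have c2: "c\<^sup>2 * D = 1/4" using D1 by (simp add: c_def power_divide power_mult_distrib)
  obtain f r where f: "lattice_form f" "rank_le f r" and r: "r \<le> d"
    "\<not> gap_t_proper (1/2) P \<longrightarrow> r < d"
    and fker: "\<And>x. f x x = 0 \<Longrightarrow> gap_sum P x = 0"
    and fle: "\<And>x. f x x \<le> box_form (gap_dims P) d x x"
    and flift: "\<And>x. \<exists>y. gap_sum P y = gap_sum P x \<and>
       (\<forall>i<d. \<bar>real_of_int (y i)\<bar> \<le> gap_dims P i * (sqrt (f x x) + 1/2))"
    using initial_form[OF tf symP] unfolding d_def by blast
  obtain g where g: "lattice_form g" "rank_le g r"
    and gker: "\<And>x. g x x = 0 \<Longrightarrow> gap_sum P x = 0"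
    and gshort: "\<And>x. gap_sum P x = 0 \<Longrightarrow> g x x \<le> c\<^sup>2 \<Longrightarrow> g x x = 0"
    and gle: "\<And>x. g x x \<le> f x x"
    and glift: "\<And>x. \<exists>y. gap_sum P y = gap_sum P x \<and> f y y \<le> g x x + real r * c\<^sup>2 / 4"
    using absorb_kernel[OF tf additive_gap_sum f fker, of "\<lambda>s. s \<le> c\<^sup>2"]
    by (metis order_refl zero_le_power2)
  interpret lattice_form g by (rule g)
  define nrm where "nrm x = sqrt (g x x)" for x
  obtain m b where m: "m \<le> r" and bpos: "\<And>i. i < m \<Longrightarrow> g (b i) (b i) > 0"
    and bgen: "\<And>x. \<exists>k. g (x - lincomb m k b) (x - lincomb m k b) = 0"
    and bbound: "\<And>k. (\<Sum>i<m. \<bar>of_int (k i)\<bar> * nrm (b i)) \<le> (2 ^ m - 1) * nrm (lincomb m k b)"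
    using reduced_basis[OF g] unfolding nrm_def by blast
  have npos: "nrm (b i) > 0" if "i < m" for i using bpos[OF that] by (simp add: nrm_def)
  \<comment> \<open>Chosen so that each of the at most \<open>D\<close> summands in
    \<open>norm_le\<close> equals \<open>s * c / 4 / D\<close>.\<close>
  define M where "M i = c / (4 * t * D * nrm (b i))" for i
  have Mpos: "M i > 0" if "i < m" for i using npos[OF that] c t D1 by (simp add: M_def)
  define Q where "Q = GAP M (\<lambda>i. gap_sum P (b i)) m"
  have Q [simp]: "gap_dims Q = M" "gap_rank Q = m" by (simp_all add: Q_def)
  have Qsum: "gap_sum Q k = gap_sum P (lincomb m k b)" for k
    unfolding gap_sum_lincomb[of Q] additive_lincomb[OF additive_gap_sum] by (simp add: Q_def comp_def)
  have Qsym: "symmetric_gap Q" using Mpos by (simp add: symmetric_gap_def)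
  have norm_le: "nrm (lincomb m k b) \<le> s * c / 4"
    if k: "\<And>i. i < m \<Longrightarrow> \<bar>real_of_int (k i)\<bar> \<le> t * s * M i" and s: "s > 0" for k s
  proof -
    have "nrm (lincomb m k b) \<le> (\<Sum>i<m. \<bar>of_int (k i)\<bar> * nrm (b i))"
      unfolding nrm_def by (rule norm_lincomb)
    also have "\<dots> \<le> (\<Sum>i<m. t * s * M i * nrm (b i))"
      using k npos by (intro sum_mono mult_right_mono) (auto intro: less_imp_le)
    also have "\<dots> = (\<Sum>i<m. s * c / 4 / D)"
    proof (intro sum.cong refl)
      fix i assume "i \<in> {..<m}"
      then show "t * s * M i * nrm (b i) = s * c / 4 / D"
        using npos[of i] t D1 by (simp add: M_def field_simps)
    qed
    also have "\<dots> = s * c / 4 * (real m / D)" by simp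
    also have "\<dots> \<le> s * c / 4 * 1"
      using s c m r dD D1 by (intro mult_left_mono) auto
    finally show ?thesis by simp
  qed
  have inject: "k i = 0" if "nrm (lincomb m k b) = 0" "i < m" for k i
  proof -
    have "(\<Sum>i<m. \<bar>of_int (k i)\<bar> * nrm (b i)) \<le> 0" using bbound[of k] that by simp
    then have "\<bar>of_int (k i)\<bar> * nrm (b i) \<le> 0"
      using member_le_sum[of i "{..<m}" "\<lambda>i. \<bar>of_int (k i)\<bar> * nrm (b i)"] npos that(2)
      by (force simp: less_imp_le)
    then show ?thesis using npos[OF that(2)] by (simp add: mult_le_0_iff)
  qed
  have proper: "gap_t_proper t Q"
    unfolding gap_t_proper_iff
  proof (intro allI impI)
    fix k l i
    assume k: "\<forall>i<gap_rank Q. \<bar>real_of_int (k i)\<bar> \<le> t * gap_dims Q i"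
      and l: "\<forall>i<gap_rank Q. \<bar>real_of_int (l i)\<bar> \<le> t * gap_dims Q i"
      and eq: "gap_sum Q k = gap_sum Q l" and i: "i < gap_rank Q"
    let ?x = "lincomb m (\<lambda>i. k i - l i) b"
    \<comment> \<open>A difference of two box vectors lies in the doubled box, so
      \<open>s = 2\<close> and its length is at most \<open>c / 2\<close>, within the range where
      kernel vectors are null.\<close>
    have "\<bar>real_of_int (k i - l i)\<bar> \<le> t * 2 * M i" if "i < m" for i
      using k[rule_format, of i] l[rule_format, of i] that by simp
    then have "nrm ?x \<le> 2 * c / 4" by (intro norm_le) auto
    then have "nrm ?x \<le> c" using c by simp
    then have "(nrm ?x)\<^sup>2 \<le> c\<^sup>2" by (intro power_mono) (auto simp: nrm_def nonneg)
    then have "g ?x ?x \<le> c\<^sup>2" by (simp add: nrm_def nonneg)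
    moreover have "gap_sum P ?x = 0"
      using eq by (simp add: lincomb_diff additive.diff[OF additive_gap_sum] Qsum)
    ultimately have "g ?x ?x = 0" by (rule gshort[rotated])
    then have "nrm ?x = 0" by (simp add: nrm_def)
    from inject[OF this, of i] i show "k i = l i" by simp
  qed
  have inner: "gap_image (gap_dilate (t * t') Q) \<subseteq> gap_image (gap_dilate t' P)" if t': "1 \<le> t'" for t'
  proof
    fix z assume "z \<in> gap_image (gap_dilate (t * t') Q)"
    then obtain k where k: "\<And>i. i < m \<Longrightarrow> \<bar>real_of_int (k i)\<bar> \<le> t * t' * M i" and z: "z = gap_sum Q k"
      unfolding mem_gap_image_iff by auto
    let ?x = "lincomb m k b"
    have "nrm ?x \<le> t' * c / 4" using t' by (intro norm_le k) auto
    then have "(nrm ?x)\<^sup>2 \<le> (t' * c / 4)\<^sup>2" by (intro power_mono) (auto simp: nrm_def nonneg)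
    then have gx: "g ?x ?x \<le> t'\<^sup>2 * (c\<^sup>2 / 16)" by (simp add: nrm_def nonneg power_mult_distrib power_divide)
    have "c\<^sup>2 * 1 \<le> c\<^sup>2 * D" using D1 by (intro mult_left_mono) auto
    then have c2': "c\<^sup>2 \<le> 1/4" using c2 by simp
    have rc: "real r * c\<^sup>2 \<le> 1/4"
    proof -
      have "real r * c\<^sup>2 \<le> D * c\<^sup>2" using r dD by (intro mult_right_mono) auto
      then show ?thesis using c2 by (simp add: mult.commute)
    qed
    obtain y where y: "gap_sum P y = gap_sum P ?x" "f y y \<le> g ?x ?x + real r * c\<^sup>2 / 4"
      using glift by blast
    obtain w where w: "gap_sum P w = gap_sum P y"
      "\<forall>i<d. \<bar>real_of_int (w i)\<bar> \<le> gap_dims P i * (sqrt (f y y) + 1/2)"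
      using flift by blast
    have t2: "1 \<le> t'\<^sup>2" using t' by simp
    have "t'\<^sup>2 * (c\<^sup>2 / 16) \<le> t'\<^sup>2 * (1/64)" using c2' by (intro mult_left_mono) auto
    \<comment> \<open>The bounds add up to \<open>t'\<^sup>2 / 64 + 1/16\<close>. Here
      \<open>1 \<le> t'\<close> absorbs the 1/16, and below it absorbs the summand 1/2 of the second
      lift.\<close>
    then have "f y y \<le> t'\<^sup>2 / 4" using y(2) gx rc t2 by linarith
    then have "f y y \<le> (t' / 2)\<^sup>2" by (simp add: power_divide)
    then have "sqrt (f y y) \<le> t' / 2" using t' by (intro real_le_lsqrt) auto
    then have st: "sqrt (f y y) + 1/2 \<le> t'" using t' by simp
    show "z \<in> gap_image (gap_dilate t' P)"
      unfolding mem_gap_image_iff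
    proof (intro exI[of _ w] conjI allI impI)
      fix i assume "i < gap_rank (gap_dilate t' P)"
      then have i: "i < d" by (simp add: d_def)
      have "gap_dims P i > 0" using symP i by (simp add: symmetric_gap_def d_def)
      then have "gap_dims P i * (sqrt (f y y) + 1/2) \<le> gap_dims P i * t'"
        using st by (intro mult_left_mono) auto
      with w(2) i show "\<bar>real_of_int (w i)\<bar> \<le> gap_dims (gap_dilate t' P) i"
        by (simp add: mult.commute) (meson order_trans)
    qed (simp add: z Qsum y w)
  qed
  \<comment> \<open>The solution of \<open>2 ^ d * sqrt D = K * c / (4 * D)\<close>: the left side
    is the coefficient bound for points of \<open>P\<close>, the right side the room in
    \<open>Q\<close>, both per unit of \<open>t'\<close>.\<close>
  define K where "K = 8 * D\<^sup>2 * 2 ^ d"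
  have K1: "K \<ge> 1"
  proof -
    have "1 * 1 \<le> D\<^sup>2 * 2 ^ d" using D1 by (intro mult_mono one_le_power) auto
    then show ?thesis by (simp add: K_def)
  qed
  have outer: "gap_image (gap_dilate t' P) \<subseteq> gap_image (gap_dilate (K * t * t') Q)" if t': "0 < t'" for t'
  proof
    fix z assume "z \<in> gap_image (gap_dilate t' P)"
    then obtain x where x: "\<And>i. i < d \<Longrightarrow> \<bar>real_of_int (x i)\<bar> \<le> t' * gap_dims P i"
      and z: "z = gap_sum P x"
      unfolding mem_gap_image_iff d_def by auto
    have "box_form (gap_dims P) d x x \<le> real d * t'\<^sup>2"
      using symP x by (intro box_form_le) (auto simp: symmetric_gap_def d_def)
    then have "g x x \<le> D * t'\<^sup>2"
      using gle[of x] fle[of x] mult_right_mono[OF dD, of "t'\<^sup>2"] by simp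
    from real_sqrt_le_mono[OF this] have nx: "nrm x \<le> sqrt D * t'"
      using t' by (simp add: nrm_def real_sqrt_mult)
    obtain k where k: "g (x - lincomb m k b) (x - lincomb m k b) = 0" using bgen by blast
    have nk: "nrm (lincomb m k b) = nrm x"
      using null_diff_both[OF k, of x] by (simp add: nrm_def)
    have zk: "z = gap_sum Q k"
      using gker[OF k] by (simp add: z Qsum additive.diff[OF additive_gap_sum])
    have "\<bar>real_of_int (k i)\<bar> \<le> K * t * t' * M i" if i: "i < m" for i
    proof -
      have "\<bar>of_int (k i)\<bar> * nrm (b i) \<le> (\<Sum>i<m. \<bar>of_int (k i)\<bar> * nrm (b i))"
        using i npos by (intro member_le_sum) (auto intro!: mult_nonneg_nonneg intro: less_imp_le)
      also have "\<dots> \<le> (2 ^ m - 1) * nrm x" using bbound[of k] nk by simp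
      also have "\<dots> \<le> 2 ^ d * (sqrt D * t')"
      proof (rule mult_mono)
        have "(2::real) ^ m \<le> 2 ^ d" using m r by (intro power_increasing) auto
        then show "(2::real) ^ m - 1 \<le> 2 ^ d" by linarith
      qed (use nx in \<open>auto simp: nrm_def nonneg\<close>)
      also have "\<dots> = K * t * t' * M i * nrm (b i)"
      proof -
        have "sqrt D * sqrt D = D" using D1 by simp
        then show ?thesis
          using npos[OF i] t D1 by (simp add: K_def M_def c_def field_simps power2_eq_square)
      qed
      finally show ?thesis using npos[OF i] by simp
    qed
    then show "z \<in> gap_image (gap_dilate (K * t * t') Q)"
      unfolding mem_gap_image_iff zk by auto
  qed
  have outer': "gap_image (gap_dilate t' P) \<subseteq> gap_image (gap_dilate (dilation_factor 64 d * t * t') Q)"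
    if t': "0 < t'" for t'
  proof (cases "d = 0")
    \<comment> \<open>In rank zero the dilation factor is 1 while \<open>K\<close> is 8, but every
      dilate of \<open>Q\<close> has image \<open>{0}\<close>.\<close>
    case True
    with m r have "m = 0" by simp
    then have "gap_image (gap_dilate s Q) = {0}" for s
      by (auto simp: mem_gap_image_iff gap_sum_def)
    then show ?thesis using outer[OF t'] by metis
  next
    case False
    then have "K \<le> dilation_factor 64 d" using dilation_factor_ge[of d] by (simp add: K_def D_def)
    then have "K * t * t' \<le> dilation_factor 64 d * t * t'" using t t' by (intro mult_right_mono) auto
    then show ?thesis using outer[OF t'] gap_image_dilate_mono[OF _ Qsym] by blast
  qed
  have size_le: "gap_size Q \<le> gap_size P"
    using inner[of 1] gap_image_dilate_mono[OF t Qsym] by (intro gap_size_mono) (auto simp: gap_dilate_one)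
  have size_ge: "real (gap_size P) \<le> (3 * (K * t)) ^ m * real (gap_size Q)"
  proof -
    have Kt: "1 \<le> K * t" using K1 t by (metis mult_1 mult_mono' zero_le_one)
    have "gap_size P \<le> gap_size (gap_dilate (K * t) Q)"
      using outer[of 1] by (intro gap_size_mono) (simp add: gap_dilate_one)
    then have "gap_size P \<le> card (gap_box (gap_dilate (K * t) Q))"
      using gap_size_le_box order_trans by blast
    then have "real (gap_size P) \<le> (\<Prod>i<m. 2 * of_int \<lfloor>K * t * M i\<rfloor> + 1)"
      using card_gap_box[of "gap_dilate (K * t) Q"] Kt Mpos by (simp add: less_imp_le)
    \<comment> \<open>Since \<open>M i\<close> is less than its floor plus 1, scaling costs
      \<open>2 * (K * t)\<close> for that missing 1; \<open>1 \<le> K * t\<close> absorbs the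
      summand 1 of the count.\<close>
    also have "\<dots> \<le> (\<Prod>i<m. 3 * (K * t) * (2 * of_int \<lfloor>M i\<rfloor> + 1))"
    proof (intro prod_mono conjI)
      fix i assume "i \<in> {..<m}"
      then have M0: "M i > 0" using Mpos by simp
      then show "0 \<le> 2 * real_of_int \<lfloor>K * t * M i\<rfloor> + 1" using Kt by simp
      have "K * t * M i \<le> K * t * (of_int \<lfloor>M i\<rfloor> + 1)"
        using Kt by (intro mult_left_mono) linarith+
      moreover have "0 \<le> (K * t) * of_int \<lfloor>M i\<rfloor>" using Kt M0 by simp
      ultimately show "2 * real_of_int \<lfloor>K * t * M i\<rfloor> + 1 \<le> 3 * (K * t) * (2 * of_int \<lfloor>M i\<rfloor> + 1)"
        using Kt of_int_floor_le[of "K * t * M i"] unfolding distrib_left by linarith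
    qed
    also have "\<dots> = (3 * (K * t)) ^ m * (\<Prod>i<m. 2 * of_int \<lfloor>M i\<rfloor> + 1)"
      by (simp add: prod.distrib)
    also have "(\<Prod>i<m. 2 * real_of_int \<lfloor>M i\<rfloor> + 1) = real (gap_size Q)"
    proof -
      have "gap_proper Q"
        using gap_t_proper_mono[OF t Qsym proper] by (simp add: gap_t_proper_def gap_proper_def gap_dilate_one)
      then show ?thesis using card_gap_box[of Q] Mpos gap_size_proper[of Q] by (simp add: less_imp_le)
    qed
    finally show ?thesis .
  qed
  define A where "A = t powr (- real d) * 2 powr (- (real d)\<^sup>2 - 64 * real d * ln (real d + 1))"
  have "A * real (gap_size P) \<le> A * ((3 * (K * t)) ^ m * real (gap_size Q))"
    using size_ge by (intro mult_left_mono) (simp_all add: A_def)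
  also have "\<dots> = A * (3 * (K * t)) ^ m * real (gap_size Q)" by simp
  also have "\<dots> \<le> 1 * real (gap_size Q)"
    unfolding A_def K_def
    by (rule mult_right_mono[OF size_constant[OF t D_def order_trans[OF m r(1)]]]) simp
  finally have size: "A * real (gap_size P) \<le> real (gap_size Q)" by simp
  have "proper_approximation 64 t P Q"
    unfolding proper_approximation_def d_def[symmetric]
    using Qsym proper outer' inner size_le size by (simp add: A_def)
  then show ?thesis using that[of Q] m r by (auto simp: d_def)
qed

section \<open>Transport between torsion-free groups\<close>

lemma gap_sum_map_gap:
  "additive \<theta> \<Longrightarrow> gap_sum (map_gap \<theta> Q) k = \<theta> (gap_sum Q k)"
  by (simp add: gap_sum_lincomb additive_lincomb gap.map_sel)

text \<open>A large \<open>t'\<close> in the inner inclusion admits each single step of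
  \<open>Q\<close>. So a map that is injective only on the group generated by the steps of
  \<open>P\<close> suffices for transport.\<close>

lemma steps_in_range:
  assumes approx: "proper_approximation C t P Q" and t: "1 \<le> t"
  shows "gap_sum Q k \<in> range (gap_sum P)"
proof -
  have Qsym: "symmetric_gap Q"
    and inner: "\<And>t'. t' \<ge> 1 \<Longrightarrow> gap_image (gap_dilate (t * t') Q) \<subseteq> gap_image (gap_dilate t' P)"
    using approx by (auto simp: proper_approximation_def)
  have "\<exists>x. gap_steps Q i = gap_sum P x" if i: "i < gap_rank Q" for i
  proof -
    define M where "M = gap_dims Q i"
    have M: "M > 0" using Qsym i by (simp add: symmetric_gap_def M_def)
    \<comment> \<open>\<open>1 / M\<close> admits the coefficient 1 at index \<open>i\<close>; the
      maximum meets the condition \<open>1 \<le> t'\<close>.\<close>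
    define s where "s = max 1 (1 / M)"
    have s: "s \<ge> 1" by (simp add: s_def)
    have "1 = 1 / M * M" using M by simp
    also have "\<dots> \<le> s * M" using M by (intro mult_right_mono) (auto simp: s_def)
    also have "\<dots> \<le> t * (s * M)" using mult_right_mono[OF t, of "s * M"] M s by simp
    finally have tsM: "1 \<le> t * s * M" by (simp add: mult.assoc)
    let ?e = "\<lambda>j. if j = i then 1 else 0 :: int"
    have "gap_sum Q ?e = gap_steps Q i"
      using i by (simp add: gap_sum_def if_distrib[of "\<lambda>n. int_scale n _"] cong: if_cong)
    moreover have "\<forall>j<gap_rank Q. \<bar>real_of_int (?e j)\<bar> \<le> t * s * gap_dims Q j"
      using tsM Qsym s t by (auto simp: M_def symmetric_gap_def less_imp_le)
    ultimately have "gap_steps Q i \<in> gap_image (gap_dilate (t * s) Q)"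
      unfolding mem_gap_image_iff by (intro exI[of _ ?e]) auto
    then have "gap_steps Q i \<in> gap_image (gap_dilate s P)" using inner[OF s] by blast
    then show ?thesis by (auto simp: mem_gap_image_iff)
  qed
  then obtain x where x: "\<And>i. i < gap_rank Q \<Longrightarrow> gap_steps Q i = gap_sum P (x i)" by metis
  have "gap_sum Q k = gap_sum P (lincomb (gap_rank Q) k x)"
    unfolding additive_lincomb[OF additive_gap_sum] unfolding gap_sum_lincomb[of Q]
    using x by (simp add: lincomb_def)
  then show ?thesis by blast
qed

text \<open>By \<open>steps_in_range\<close>, all sums of \<open>Q\<close> lie in the subgroup on
  which \<theta> is injective, so inclusions, sizes and properness carry over.\<close>

lemma transfer_approximation:
  fixes \<theta> :: "'b::ab_group_add \<Rightarrow> 'a::ab_group_add"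
  assumes add: "additive \<theta>"
    and P': "gap_dims P' = gap_dims P" "gap_rank P' = gap_rank P"
      "\<And>k. gap_sum P' k = \<theta> (gap_sum P k)"
    and inj: "\<And>k. \<theta> (gap_sum P k) = 0 \<Longrightarrow> gap_sum P k = 0"
    and approx: "proper_approximation C t P Q" and t: "1 \<le> t"
  shows "proper_approximation C t P' (map_gap \<theta> Q)"
proof -
  let ?H = "range (gap_sum P)" and ?Q = "map_gap \<theta> Q"
  have injH: "inj_on \<theta> ?H"
  proof (rule inj_onI)
    fix x y assume "x \<in> ?H" "y \<in> ?H" and eq: "\<theta> x = \<theta> y"
    then obtain k l where kl: "x = gap_sum P k" "y = gap_sum P l" by blast
    then have "\<theta> (gap_sum P (k - l)) = 0"
      using eq by (simp add: additive.diff[OF additive_gap_sum] additive.diff[OF add])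
    from inj[OF this] show "x = y" by (simp add: kl additive.diff[OF additive_gap_sum])
  qed
  have QH: "gap_sum Q k \<in> ?H" for k by (rule steps_in_range[OF approx t])
  have Qsum: "gap_sum ?Q k = \<theta> (gap_sum Q k)" for k by (rule gap_sum_map_gap[OF add])
  have Qsel: "gap_dims ?Q = gap_dims Q" "gap_rank ?Q = gap_rank Q" by (simp_all add: gap.map_sel)
  have imP: "gap_image (gap_dilate s P') = \<theta> ` gap_image (gap_dilate s P)" for s
    by (simp add: gap_image_def gap_box_def P' image_image)
  have imQ: "gap_image (gap_dilate s ?Q) = \<theta> ` gap_image (gap_dilate s Q)" for s
    by (simp add: gap_image_def gap_box_def Qsel Qsum image_image)
  have sizes: "gap_size P' = gap_size P" "gap_size ?Q = gap_size Q"
  proof -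
    have "inj_on \<theta> (gap_image P)" "inj_on \<theta> (gap_image Q)"
      using QH by (auto intro!: inj_on_subset[OF injH] simp: gap_image_def)
    then show "gap_size P' = gap_size P" "gap_size ?Q = gap_size Q"
      using imP[of 1] imQ[of 1] by (simp_all add: gap_size_def gap_dilate_one card_image)
  qed
  have "gap_t_proper t ?Q"
    unfolding gap_t_proper_iff Qsel Qsum
  proof (intro allI impI)
    fix k l i
    assume k: "\<forall>i<gap_rank Q. \<bar>real_of_int (k i)\<bar> \<le> t * gap_dims Q i"
      and l: "\<forall>i<gap_rank Q. \<bar>real_of_int (l i)\<bar> \<le> t * gap_dims Q i"
      and eq: "\<theta> (gap_sum Q k) = \<theta> (gap_sum Q l)" and i: "i < gap_rank Q"
    have "gap_t_proper t Q" using approx by (simp add: proper_approximation_def)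
    from this[unfolded gap_t_proper_iff, rule_format, OF _ _ inj_onD[OF injH eq QH QH] i] k l
    show "k i = l i" by simp
  qed
  moreover have "symmetric_gap ?Q"
    using approx by (simp add: proper_approximation_def symmetric_gap_def Qsel)
  ultimately show ?thesis
    using approx unfolding proper_approximation_def imP imQ sizes P'(2)
    by (auto intro!: image_mono)
qed

lemma torsion_free_poly_mapping: "torsion_free_group TYPE((nat, int) poly_mapping)"
  unfolding torsion_free_group_def
proof (intro allI impI notI)
  fix n :: int and x :: "nat \<Rightarrow>\<^sub>0 int"
  assume n: "n \<noteq> 0" and x: "x \<noteq> 0" and eq: "int_scale n x = 0"
  have "n * Poly_Mapping.lookup x i = Poly_Mapping.lookup (int_scale n x) i" for i
    using additive_int_scale[of "\<lambda>x. Poly_Mapping.lookup x i" n x] by (simp add: additive_def lookup_add)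
  then have "x = 0" using n eq by (intro poly_mapping_eqI) simp
  with x show False by simp
qed

text \<open>A finitely generated torsion-free group is free: a reduced basis of the lattice modulo
  the full kernel provides the coordinates.\<close>

lemma free_model:
  fixes P :: "'a::ab_group_add gap"
  assumes tf: "torsion_free_group TYPE('a)" and symP: "symmetric_gap P"
  obtains R :: "(nat, int) poly_mapping gap" and \<theta> where "additive \<theta>"
    "gap_dims P = gap_dims R" "gap_rank P = gap_rank R" "\<And>k. gap_sum P k = \<theta> (gap_sum R k)"
    "\<And>k. \<theta> (gap_sum R k) = 0 \<Longrightarrow> gap_sum R k = 0"
proof -
  define d where "d = gap_rank P"
  define f where "f = box_form (gap_dims P) d"
  have N: "\<And>i. i < d \<Longrightarrow> 0 < gap_dims P i" using symP by (simp add: symmetric_gap_def d_def)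
  have f: "lattice_form f" "rank_le f d"
    unfolding f_def by (rule lattice_box_form[OF N] rank_le_box_form; assumption)+
  have fker: "gap_sum P x = 0" if "f x x = 0" for x
    using that box_form_null[where N = "gap_dims P" and d = d and x = x, OF N]
    unfolding f_def gap_sum_def d_def[symmetric] by simp
  obtain g where g: "lattice_form g" "rank_le g d"
    and gker: "\<And>x. g x x = 0 \<Longrightarrow> gap_sum P x = 0" "\<And>x. gap_sum P x = 0 \<Longrightarrow> g x x = 0"
    using absorb_kernel[OF tf additive_gap_sum f fker, of "\<lambda>_. True"] by metis
  obtain m b where bpos: "\<And>i. i < m \<Longrightarrow> g (b i) (b i) > 0"
    and bgen: "\<And>x. \<exists>k. g (x - lincomb m k b) (x - lincomb m k b) = 0"
    and bbound: "\<And>k. (\<Sum>i<m. \<bar>of_int (k i)\<bar> * sqrt (g (b i) (b i)))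
        \<le> (2 ^ m - 1) * sqrt (g (lincomb m k b) (lincomb m k b))"
    using reduced_basis[OF g] by blast
  define e :: "nat \<Rightarrow> nat \<Rightarrow> int" where "e j i = (if i = j then 1 else 0)" for j i
  have "\<exists>k. gap_sum P (e j) = gap_sum P (lincomb m k b)" for j
  proof -
    obtain k where "g (e j - lincomb m k b) (e j - lincomb m k b) = 0" using bgen by blast
    from gker(1)[OF this] show ?thesis by (auto simp: additive.diff[OF additive_gap_sum])
  qed
  then obtain k where k: "\<And>j. gap_sum P (e j) = gap_sum P (lincomb m (k j) b)" by metis
  \<comment> \<open>\<open>p j\<close> records the basis coordinates of the \<open>j\<close>-th step
    of \<open>P\<close>; the \<open>p j\<close> are the steps of the model.\<close>
  define p where "p j = (\<Sum>i<m. Poly_Mapping.single i (k j i))" for j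
  have p: "Poly_Mapping.lookup (p j) i = (if i < m then k j i else 0)" for i j
    by (simp add: p_def lookup_sum lookup_single when_def)
  define \<theta> where "\<theta> q = lincomb m (Poly_Mapping.lookup q) (\<lambda>i. gap_sum P (b i))"
    for q :: "nat \<Rightarrow>\<^sub>0 int"
  have add: "additive \<theta>"
    by (simp add: additive_def \<theta>_def lincomb_def lookup_add int_scale_add_left sum.distrib)
  have \<theta>: "\<theta> q = gap_sum P (lincomb m (Poly_Mapping.lookup q) b)" for q
    by (simp add: \<theta>_def additive_lincomb[OF additive_gap_sum] comp_def)
  define R where "R = GAP (gap_dims P) p d"
  have R: "gap_sum R x = lincomb d x p" for x unfolding gap_sum_lincomb[of R] by (simp add: R_def)
  have step: "\<theta> (p j) = gap_steps P j" if "j < d" for j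
  proof -
    have "lincomb m (Poly_Mapping.lookup (p j)) b = lincomb m (k j) b"
      by (rule lincomb_cong) (simp add: p)
    then have "\<theta> (p j) = gap_sum P (e j)" by (simp add: \<theta> k)
    also have "\<dots> = gap_steps P j"
      using that by (simp add: gap_sum_def d_def e_def if_distrib[of "\<lambda>n. int_scale n _"] cong: if_cong)
    finally show ?thesis .
  qed
  show ?thesis
  proof (rule that[OF add])
    show "gap_dims P = gap_dims R" "gap_rank P = gap_rank R" by (simp_all add: R_def d_def)
    show "gap_sum P x = \<theta> (gap_sum R x)" for x
      unfolding R additive_lincomb[OF add] using step by (simp add: gap_sum_def lincomb_def d_def)
    fix x assume "\<theta> (gap_sum R x) = 0"
    \<comment> \<open>The kernel is exactly the null space of \<open>g\<close>, and the reduced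
      basis bound then makes every coordinate zero.\<close>
    then have "g (lincomb m (Poly_Mapping.lookup (gap_sum R x)) b)
        (lincomb m (Poly_Mapping.lookup (gap_sum R x)) b) = 0" by (intro gker(2)) (simp add: \<theta>)
    with bbound[of "Poly_Mapping.lookup (gap_sum R x)"]
    have le: "(\<Sum>i<m. \<bar>of_int (Poly_Mapping.lookup (gap_sum R x) i)\<bar> * sqrt (g (b i) (b i))) \<le> 0"
      by simp
    show "gap_sum R x = 0"
    proof (rule poly_mapping_eqI)
      fix i
      show "Poly_Mapping.lookup (gap_sum R x) i = Poly_Mapping.lookup 0 i"
      proof (cases "i < m")
        case True
        have "\<bar>of_int (Poly_Mapping.lookup (gap_sum R x) i)\<bar> * sqrt (g (b i) (b i))
            \<le> (\<Sum>i<m. \<bar>of_int (Poly_Mapping.lookup (gap_sum R x) i)\<bar> * sqrt (g (b i) (b i)))"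
          using True bpos by (intro member_le_sum) (auto simp: less_imp_le)
        with le have "\<bar>of_int (Poly_Mapping.lookup (gap_sum R x) i)\<bar> * sqrt (g (b i) (b i)) \<le> 0"
          by linarith
        with bpos[OF True] show ?thesis by (simp add: mult_le_0_iff)
      next
        case False
        have "additive (\<lambda>q. Poly_Mapping.lookup q i)" by (simp add: additive_def lookup_add)
        from additive_lincomb[OF this, of d x p] False show ?thesis
          by (simp add: R lincomb_def p)
      qed
    qed
  qed
qed

text \<open>The witness 64 makes the choice meaningful. The chosen number may differ from 64, so
  this property over one free group is all that the final proof can use.\<close>

lemma gap_constant_valid:
  "0 < gap_constant \<and> (\<forall>(P :: (nat, int) poly_mapping gap) t. symmetric_gap P \<longrightarrow> 1 \<le> t \<longrightarrow>
     (\<exists>Q. gap_rank Q \<le> gap_rank P \<and> proper_approximation gap_constant t P Q) \<and>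
     (\<not> gap_t_proper (1/2) P \<longrightarrow>
       (\<exists>Q. int (gap_rank Q) \<le> int (gap_rank P) - 1 \<and> proper_approximation gap_constant t P Q)))"
  unfolding gap_constant_def
proof (rule someI[where x = 64], intro conjI allI impI)
  fix P :: "(nat, int) poly_mapping gap" and t :: real
  assume "symmetric_gap P" "1 \<le> t"
  then obtain Q where Q: "gap_rank Q \<le> gap_rank P"
    "\<not> gap_t_proper (1/2) P \<longrightarrow> gap_rank Q < gap_rank P" "proper_approximation 64 t P Q"
    using approximation_exists[OF torsion_free_poly_mapping] by blast
  then show "\<exists>Q. gap_rank Q \<le> gap_rank P \<and> proper_approximation 64 t P Q" by blast
  show "\<exists>Q. int (gap_rank Q) \<le> int (gap_rank P) - 1 \<and> proper_approximation 64 t P Q"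
    if "\<not> gap_t_proper (1/2) P"
    using that Q by (intro exI[of _ Q]) auto
qed simp

theorem theorem1p10:
  assumes "torsion_free_group TYPE('a::ab_group_add)"
  shows "0 < gap_constant \<and>
    (\<forall>(P :: 'a gap) (t::real). symmetric_gap P \<longrightarrow> 1 \<le> t \<longrightarrow>
      (\<exists>Q. gap_rank Q \<le> gap_rank P \<and>
           proper_approximation gap_constant t P Q \<and>
           gap_image Q \<subseteq> gap_image P \<and>
           gap_image P
             \<subseteq> gap_image (gap_dilate (dilation_factor gap_constant (gap_rank P) * t) Q)) \<and>
      (\<not> gap_t_proper (1/2) P \<longrightarrow>
        (\<exists>Q. int (gap_rank Q) \<le> int (gap_rank P) - 1 \<and>
             proper_approximation gap_constant t P Q)))"
proof (rule conjI[OF conjunct1[OF gap_constant_valid]], intro allI impI)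
  fix P :: "'a gap" and t :: real
  assume symP: "symmetric_gap P" and t: "1 \<le> t"
  \<comment> \<open>The problem moves to a model in the free group, where
    \<open>gap_constant\<close> is known to work.\<close>
  obtain R :: "(nat, int) poly_mapping gap" and \<theta> where \<theta>: "additive \<theta>"
    "gap_dims P = gap_dims R" "gap_rank P = gap_rank R" "\<And>k. gap_sum P k = \<theta> (gap_sum R k)"
    "\<And>k. \<theta> (gap_sum R k) = 0 \<Longrightarrow> gap_sum R k = 0"
    by (rule free_model[OF assms symP], rule that)
  have symR: "symmetric_gap R" using symP \<theta>(2,3) by (simp add: symmetric_gap_def)
  note valid = gap_constant_valid[THEN conjunct2, THEN spec, THEN spec, THEN mp, THEN mp, OF symR t]
  have R: "\<exists>Q. gap_rank Q \<le> gap_rank R \<and> proper_approximation gap_constant t R Q"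
    "\<not> gap_t_proper (1/2) R \<longrightarrow>
       (\<exists>Q. int (gap_rank Q) \<le> int (gap_rank R) - 1 \<and> proper_approximation gap_constant t R Q)"
    by (rule conjunct1[OF valid], rule conjunct2[OF valid])
  have transfer: "proper_approximation gap_constant t P (map_gap \<theta> Q)"
    if "proper_approximation gap_constant t R Q" for Q
    using transfer_approximation[OF \<theta> that t] .
  have special: "gap_image Q \<subseteq> gap_image P"
    "gap_image P \<subseteq> gap_image (gap_dilate (dilation_factor gap_constant (gap_rank P) * t) Q)"
    if Q: "proper_approximation gap_constant t P Q" for Q
  proof -
    \<comment> \<open>Both inclusions at \<open>t' = 1\<close>; the first then uses that
      \<open>Q\<close> lies in its dilate by \<open>t\<close>.\<close>
    have "symmetric_gap Q" and inner: "gap_image (gap_dilate (t * 1) Q) \<subseteq> gap_image (gap_dilate 1 P)"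
      and outer: "gap_image (gap_dilate 1 P)
        \<subseteq> gap_image (gap_dilate (dilation_factor gap_constant (gap_rank P) * t * 1) Q)"
      using Q zero_less_one order_refl unfolding proper_approximation_def by metis+
    then show "gap_image Q \<subseteq> gap_image P"
      using gap_image_dilate_mono[OF t, of Q] by (simp add: gap_dilate_one)
    show "gap_image P \<subseteq> gap_image (gap_dilate (dilation_factor gap_constant (gap_rank P) * t) Q)"
      using outer by (simp add: gap_dilate_one)
  qed
  show "(\<exists>Q. gap_rank Q \<le> gap_rank P \<and> proper_approximation gap_constant t P Q \<and>
           gap_image Q \<subseteq> gap_image P \<and>
           gap_image P
             \<subseteq> gap_image (gap_dilate (dilation_factor gap_constant (gap_rank P) * t) Q)) \<and>
      (\<not> gap_t_proper (1/2) P \<longrightarrow>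
        (\<exists>Q. int (gap_rank Q) \<le> int (gap_rank P) - 1 \<and>
             proper_approximation gap_constant t P Q))"
  proof (intro conjI impI)
    from R(1) obtain Q where "gap_rank Q \<le> gap_rank R" "proper_approximation gap_constant t R Q"
      by blast
    then show "\<exists>Q. gap_rank Q \<le> gap_rank P \<and> proper_approximation gap_constant t P Q \<and>
           gap_image Q \<subseteq> gap_image P \<and>
           gap_image P
             \<subseteq> gap_image (gap_dilate (dilation_factor gap_constant (gap_rank P) * t) Q)"
      using transfer special \<theta>(3) by (intro exI[of _ "map_gap \<theta> Q"]) (simp add: gap.map_sel)
  next
    assume "\<not> gap_t_proper (1/2) P"
    \<comment> \<open>Injectivity of \<theta> on the sums of \<open>R\<close> makes collisions in
      \<open>P\<close> and \<open>R\<close> the same, so failure of properness passes to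
      \<open>R\<close>.\<close>
    moreover have "gap_sum P k = gap_sum P l \<longleftrightarrow> gap_sum R k = gap_sum R l" for k l
      using \<theta>(5)[of "k - l"] unfolding \<theta>(4)
      by (auto simp: additive.diff[OF additive_gap_sum] additive.diff[OF \<theta>(1)])
    ultimately have "\<not> gap_t_proper (1/2) R" by (simp only: gap_t_proper_iff \<theta>(2,3) not_False_eq_True)
    then obtain Q where "int (gap_rank Q) \<le> int (gap_rank R) - 1"
      "proper_approximation gap_constant t R Q" using R(2) by blast
    then show "\<exists>Q. int (gap_rank Q) \<le> int (gap_rank P) - 1 \<and> proper_approximation gap_constant t P Q"
      using transfer \<theta>(3) by (intro exI[of _ "map_gap \<theta> Q"]) (simp add: gap.map_sel)
  qed
qed

end
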